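(* Let $d\ge2$ be an integer, let $L\in\mathbb{N}_0$, and let $\phi\colon[0,\infty)\to[0,\infty)$ be a continuous function with $\phi(t)>0$ for $0\le t\le\frac12$ and $\phi(t)=0$ for $t\ge1$. There is a constant $r>0$, depending only on $d$, $L$ and $\phi$, such that the following holds. Let $f\in C^{L+1}(\mathbb{S}^{d-1})$, let $c>0$, and let $\big(Y^\ell=\{y_1^\ell,\dots,y_{N_\ell}^\ell\}\big)_{\ell\in\mathbb{N}}$ be a family of node sets in $\mathbb{S}^{d-1}$ with fill distances $h_\ell$ and separation distances $q_\ell$ such that $h_\ell/q_\ell\le c$ for all $\ell\in\mathbb{N}$ and $h_\ell\to0$ as $\ell\to\infty$. Choose $R\ge r$, set $\delta_\ell:=R\,h_\ell$ and $$w_\ell(y,z):=\phi\!\left(\frac{d(y,z)}{\delta_\ell}\right),\qquad y,z\in\mathbb{S}^{d-1}.$$ Let $f^\ell:=\mathcal{M}f$ be the moving least squares (MLS) approximation of $f$ with respect to the ansatz space $\mathcal{H}_{L,2}(\mathbb{S}^{d-1})$, the nodes $Y^\ell$ and the weight function $w_\ell$. Then $$\|f-f^\ell\|_\infty=\mathcal{O}\big(h_\ell^{L+1}\big)\qquad\text{as }\ell\to\infty .$$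
   Context: $\mathbb{S}^{d-1}=\{y\in\mathbb{R}^d : \|y\|_2=1\}$, with great circle distance $d(y,z)=\arccos(\langle y,z\rangle)$. Functions take values in $\mathbb{K}\in\{\mathbb{R},\mathbb{C}\}$, and all function spaces are linear over the field $\mathbb{K}$ that $f$ maps into. $\|g\|_\infty=\sup_{y\in\mathbb{S}^{d-1}}|g(y)|$. $\mathrm{Hom}_\ell(\mathbb{R}^d)$ is the space of homogeneous polynomials of degree $\ell$ on $\mathbb{R}^d$ (including $0$), $\mathrm{Harm}_\ell(\mathbb{S}^{d-1})=\{h|_{\mathbb{S}^{d-1}} : h\in\mathrm{Hom}_\ell(\mathbb{R}^d),\ \Delta_d h\equiv0\}$ with $\Delta_d$ the Laplacian, and $\mathcal{H}_{L,2}(\mathbb{S}^{d-1})=\bigoplus_{0\le\ell\le L,\ \ell\equiv L\pmod 2}\mathrm{Harm}_\ell(\mathbb{S}^{d-1})$. For distinct nodes $y_1,\dots,y_N\in\mathbb{S}^{d-1}$ ($N\ge2$) the fill distance is $h=\sup_{y\in\mathbb{S}^{d-1}}\min_{i}d(y_i,y)$ and the separation distance is $q=\frac12\min_{i\ne j}d(y_i,y_j)$. MLS approximation: given nodes $y_1,\dots,y_N$, a finite-dimensional linear ansatz space $\mathcal{G}$ of functions on $\mathbb{S}^{d-1}$ and a weight function $w\colon\mathbb{S}^{d-1}\times\mathbb{S}^{d-1}\to[0,\infty)$ such that the problem $\min_{g\in\mathcal{G}}\sum_{i=1}^N w(y,y_i)\,|f(y_i)-g(y_i)|^2$ possesses a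 unique solution $g_y\in\mathcal{G}$, the MLS approximation of $f$ in the center $y$ is $\mathcal{M}f(y):=g_y(y)$. The function $\mathcal{M}f$ is obtained by solving this problem separately for each center $y\in\mathbb{S}^{d-1}$ (unique solvability is part of the definition). *)

theory Defs
  imports "HOL-Analysis.Analysis" "HOL-Library.Landau_Symbols"
begin

text \<open>
  The ambient space \<open>\<real>\<^sup>d\<close> is \<^typ>\<open>real^'n\<close> with \<open>d = CARD('n)\<close>, and the unit sphere
  is \<^term>\<open>sphere 0 1 :: (real^'n) set\<close>. The scalar field \<open>\<K>\<close> is a type \<open>'k\<close> of class
  \<^class>\<open>real_normed_field\<close>, meant to be \<^typ>\<open>real\<close> or \<^typ>\<open>complex\<close>.
  Elements of function spaces on the sphere are extensional functions (\<^const>\<open>undefined\<close> off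
  the sphere), so that equality of elements is equality of functions on the sphere.
\<close>

definition gc_dist :: "real^'n \<Rightarrow> real^'n \<Rightarrow> real" where
  "gc_dist y z = arccos (y \<bullet> z)"

definition sphere_norm :: "(real^'n \<Rightarrow> 'k::real_normed_vector) \<Rightarrow> real" where
  "sphere_norm g = (SUP y\<in>sphere 0 1. norm (g y))"


subsection \<open>Differentiability\<close>

definition partial_deriv ::
    "'n \<Rightarrow> (real^'n \<Rightarrow> 'k::real_normed_vector) \<Rightarrow> real^'n \<Rightarrow> 'k" where
  "partial_deriv i F x = frechet_derivative F (at x) (axis i 1)"

definition laplacian :: "(real^'n \<Rightarrow> 'k::real_normed_vector) \<Rightarrow> real^'n \<Rightarrow> 'k" where
  "laplacian F x = (\<Sum>i\<in>UNIV. partial_deriv i (partial_deriv i F) x)"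

text \<open>Class \<open>C\<^sup>k\<close> on a set \<open>U\<close>, to be used for open \<open>U\<close> only (the derivatives are taken in
  the full space).\<close>

primrec Ck_on :: "nat \<Rightarrow> (real^'n) set \<Rightarrow> (real^'n \<Rightarrow> 'k::real_normed_vector) \<Rightarrow> bool" where
  "Ck_on 0 U F \<longleftrightarrow> continuous_on U F"
| "Ck_on (Suc k) U F \<longleftrightarrow>
     (\<forall>x\<in>U. F differentiable (at x)) \<and> (\<forall>i. Ck_on k U (partial_deriv i F))"

text \<open>A function on the embedded submanifold \<open>S\<^sup>d\<^sup>-\<^sup>1\<close> is \<open>C\<^sup>k\<close> iff near every point it is the
  restriction of a \<open>C\<^sup>k\<close> function on an open set of the ambient space. Values of \<open>f\<close> off the
  sphere are irrelevant.\<close>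

definition Ck_sphere :: "nat \<Rightarrow> (real^'n \<Rightarrow> 'k::real_normed_vector) \<Rightarrow> bool" where
  "Ck_sphere k f \<longleftrightarrow>
     (\<forall>y\<in>sphere 0 1. \<exists>U F. open U \<and> y \<in> U \<and> Ck_on k U F \<and> (\<forall>x\<in>U \<inter> sphere 0 1. F x = f x))"


subsection \<open>Homogeneous polynomials and spherical harmonics\<close>

definition multi_indices :: "nat \<Rightarrow> ('n::finite \<Rightarrow> nat) set" where
  "multi_indices l = {\<alpha>. (\<Sum>i\<in>UNIV. \<alpha> i) = l}"

lemma finite_multi_indices: "finite (multi_indices l :: ('n::finite \<Rightarrow> nat) set)"
proof (rule finite_subset)
  show "multi_indices l \<subseteq> (UNIV \<rightarrow>\<^sub>E {..l} :: ('n \<Rightarrow> nat) set)"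
    by (auto simp: multi_indices_def intro: member_le_sum)
  show "finite (UNIV \<rightarrow>\<^sub>E {..l} :: ('n \<Rightarrow> nat) set)"
    by (rule finite_PiE) auto
qed

definition Hom_space :: "nat \<Rightarrow> (real^'n \<Rightarrow> 'k::real_normed_field) set" where
  "Hom_space l =
     {\<lambda>x. \<Sum>\<alpha>\<in>multi_indices l. a \<alpha> * of_real (\<Prod>i\<in>UNIV. (x $ i) ^ \<alpha> i) | a. True}"

definition Harm_space :: "nat \<Rightarrow> (real^'n \<Rightarrow> 'k::real_normed_field) set" where
  "Harm_space l = {restrict p (sphere 0 1) | p. p \<in> Hom_space l \<and> (\<forall>x. laplacian p x = 0)}"

text \<open>The space \<open>\<H>\<^bsub>L,2\<^esub>\<close>. As a set of functions, the internal direct sum is the set of sums.\<close>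

definition H2_space :: "nat \<Rightarrow> (real^'n \<Rightarrow> 'k::real_normed_field) set" where
  "H2_space L =
     {restrict (\<lambda>x. \<Sum>l\<in>{l. l \<le> L \<and> l mod 2 = L mod 2}. g l x) (sphere 0 1)
       | g. \<forall>l. l \<le> L \<and> l mod 2 = L mod 2 \<longrightarrow> g l \<in> Harm_space l}"


subsection \<open>Node sets\<close>

definition node_set :: "(real^'n) set \<Rightarrow> bool" where
  "node_set Y \<longleftrightarrow> finite Y \<and> 2 \<le> card Y \<and> Y \<subseteq> sphere 0 1"

definition fill_dist :: "(real^'n) set \<Rightarrow> real" where
  "fill_dist Y = (SUP y\<in>sphere 0 1. Min ((\<lambda>z. gc_dist z y) ` Y))"

definition sep_dist :: "(real^'n) set \<Rightarrow> real" where
  "sep_dist Y = 1 / 2 * Min {gc_dist y z | y z. y \<in> Y \<and> z \<in> Y \<and> y \<noteq> z}"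


subsection \<open>Moving least squares\<close>

definition mls_functional ::
    "(real^'n) set \<Rightarrow> (real^'n \<Rightarrow> real^'n \<Rightarrow> real) \<Rightarrow> (real^'n \<Rightarrow> 'k::real_normed_vector) \<Rightarrow>
      real^'n \<Rightarrow> (real^'n \<Rightarrow> 'k) \<Rightarrow> real" where
  "mls_functional Y w f y g = (\<Sum>z\<in>Y. w y z * (norm (f z - g z))\<^sup>2)"

definition mls_solution ::
    "(real^'n \<Rightarrow> 'k::real_normed_vector) set \<Rightarrow> (real^'n) set \<Rightarrow>
      (real^'n \<Rightarrow> real^'n \<Rightarrow> real) \<Rightarrow> (real^'n \<Rightarrow> 'k) \<Rightarrow> real^'n \<Rightarrow> (real^'n \<Rightarrow> 'k) \<Rightarrow> bool" where
  "mls_solution G Y w f y g \<longleftrightarrow>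
     g \<in> G \<and> (\<forall>g'\<in>G. mls_functional Y w f y g \<le> mls_functional Y w f y g')"

text \<open>Meaningful only at centers \<open>y\<close> where the minimizer is unique,
  i.e. \<open>\<exists>!g. mls_solution G Y w f y g\<close>.\<close>

definition mls_approx ::
    "(real^'n \<Rightarrow> 'k::real_normed_vector) set \<Rightarrow> (real^'n) set \<Rightarrow>
      (real^'n \<Rightarrow> real^'n \<Rightarrow> real) \<Rightarrow> (real^'n \<Rightarrow> 'k) \<Rightarrow> real^'n \<Rightarrow> 'k" where
  "mls_approx G Y w f y = (THE g. mls_solution G Y w f y g) y"

text \<open>The MLS approximation \<open>\<M>f\<close> is defined at every center of the sphere, and \<open>f - \<M>f\<close> is
  bounded there, so that its \<^const>\<open>sphere_norm\<close> is a genuine supremum.\<close>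

definition mls_well_defined ::
    "(real^'n \<Rightarrow> 'k::real_normed_vector) set \<Rightarrow> (real^'n) set \<Rightarrow>
      (real^'n \<Rightarrow> real^'n \<Rightarrow> real) \<Rightarrow> (real^'n \<Rightarrow> 'k) \<Rightarrow> bool" where
  "mls_well_defined G Y w f \<longleftrightarrow>
     (\<forall>y\<in>sphere 0 1. \<exists>!g. mls_solution G Y w f y g) \<and>
     bounded ((\<lambda>y. f y - mls_approx G Y w f y) ` sphere 0 1)"

end

theory Submission
  imports Defs "HOL-Computational_Algebra.Polynomial"
begin

text \<open>
  On the sphere, \<open>\<H>\<^bsub>L,2\<^esub>\<close> consists of the restrictions of all homogeneous polynomials of degree
  \<open>L\<close>, because \<open>p - \<bar>x\<bar>\<^sup>2 q\<close> is harmonic for a suitable \<open>q\<close> of degree \<open>L - 2\<close>. This space is invariant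
  under linear maps, which has two consequences. First, a linear change of variables
  moves a cap of radius \<open>\<delta>\<close> around any center to one fixed configuration, so that the nodes in the cap
  determine \<open>p\<close> and control \<open>p(y)\<close>, with uniform constants, as soon as the fill distance is a small enough
  multiple of \<open>\<delta>\<close>. Second, the homogenised Taylor polynomial on the tangent plane at \<open>y\<close> approximates \<open>f\<close>
  near \<open>y\<close> to order \<open>L + 1\<close>. Comparing the minimizer with this approximant bounds the minimum by a
  multiple of \<open>\<delta>\<^bsup>2(L+1)\<^esup>\<close>, since quasi-uniformity bounds the number of nodes in the cap; hence
  both are close at the nodes in the inner cap, and by the norming property also at \<open>y\<close>.
\<close>

subsection \<open>Homogeneous polynomials\<close>

text \<open>On the affine plane \<open>x \<bullet> y = 1\<close> the homogeneous polynomials of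
  degree \<open>L\<close> become all polynomials of degree at most \<open>L\<close>. This is why
  harmonics of a single parity already have full local approximation order, and why the argument
  leaves the individual harmonic spaces: shrinking a cap is not an orthogonal map, and only the
  whole homogeneous space survives it. The obstacle is uniformity over centres, scales and irregular
  node positions. It is overcome by perturbation: a finite set of interpolation points in a fixed
  disc is chosen once, and nodes whose rescaled projections come close to these points inherit the
  estimate. How close they must come is a matter of the polynomial space alone; it determines
  \<open>\<eta>\<close>, and \<open>1 / \<eta>\<close> is the threshold for \<open>R\<close>. One
  estimate serves twice: with bound 0 it gives unique solvability of the minimisation, with a
  positive bound the error. Distances are Euclidean throughout. Geodesic distance is at most 3 times
  larger, so the inner cap of radius \<open>\<delta> / 8\<close> stays where the argument of
  \<open>\<phi>\<close> is below 1/2.\<close>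

inductive hom_poly :: "nat \<Rightarrow> (real^'n \<Rightarrow> 'k::real_normed_field) \<Rightarrow> bool" where
  const: "hom_poly 0 (\<lambda>_. c)"
| zero: "hom_poly l (\<lambda>_. 0)"
| coord: "hom_poly l p \<Longrightarrow> hom_poly (Suc l) (\<lambda>x. of_real (x $ i) * p x)"
| add: "hom_poly l p \<Longrightarrow> hom_poly l q \<Longrightarrow> hom_poly l (\<lambda>x. p x + q x)"

lemma hom_poly_cmult: "hom_poly l p \<Longrightarrow> hom_poly l (\<lambda>x. c * p x)"
proof (induction rule: hom_poly.induct)
  case (coord l p i)
  show ?case using hom_poly.coord[OF coord.IH, of i] by (simp add: mult_ac)
qed (auto simp: distrib_left intro: hom_poly.intros)

lemma hom_poly_sum:
  "(\<And>a. a \<in> A \<Longrightarrow> hom_poly l (p a)) \<Longrightarrow> hom_poly l (\<lambda>x. \<Sum>a\<in>A. p a x)"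
  by (induction A rule: infinite_finite_induct) (auto intro: hom_poly.intros)

lemma hom_poly_diff: "hom_poly l p \<Longrightarrow> hom_poly l q \<Longrightarrow> hom_poly l (\<lambda>x. p x - q x)"
  using hom_poly.add[of l p "\<lambda>x. (- 1) * q x"] hom_poly_cmult[of l q "- 1"] by simp

lemma hom_poly_mult: "hom_poly l p \<Longrightarrow> hom_poly m q \<Longrightarrow> hom_poly (l + m) (\<lambda>x. p x * q x)"
proof (induction rule: hom_poly.induct)
  case (coord l p i)
  show ?case using hom_poly.coord[OF coord.IH[OF coord.prems], of i] by (simp add: mult_ac)
qed (auto simp: distrib_right intro: hom_poly.intros hom_poly_cmult)

lemma hom_poly_power: "hom_poly l p \<Longrightarrow> hom_poly (l * k) (\<lambda>x. p x ^ k)"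
proof (induction k)
  case 0
  show ?case using hom_poly.const[of 1] by simp
next
  case (Suc k)
  then show ?case using hom_poly_mult[of l p "l * k" "\<lambda>x. p x ^ k"] by simp
qed

lemma hom_poly_coord: "hom_poly 1 (\<lambda>x. of_real (x $ i))"
  using hom_poly.coord[OF hom_poly.const[of 1], of i] by simp

lemma hom_poly_linear_form:
  fixes g :: "real^'n \<Rightarrow> real"
  assumes "linear g"
  shows "hom_poly 1 (\<lambda>x. of_real (g x) :: 'k::real_normed_field)"
proof -
  have g: "g x = (\<Sum>i\<in>UNIV. g (axis i 1) * x $ i)" for x
  proof -
    have "g x = g (\<Sum>i\<in>UNIV. x $ i *\<^sub>R axis i 1)"
      by (simp add: basis_expansion scalar_mult_eq_scaleR[symmetric])
    then show ?thesis
      by (simp add: linear_sum[OF assms] linear_scale[OF assms] mult.commute)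
  qed
  have "hom_poly 1 (\<lambda>x. \<Sum>i\<in>UNIV. of_real (g (axis i 1)) * of_real (x $ i) :: 'k)"
    by (intro hom_poly_sum hom_poly_cmult hom_poly_coord)
  also have "(\<lambda>x. \<Sum>i\<in>UNIV. of_real (g (axis i 1)) * of_real (x $ i) :: 'k) = (\<lambda>x. of_real (g x))"
    by (subst g) simp
  finally show ?thesis .
qed

text \<open>Needed for two maps that do not preserve harmonicity in general: the anisotropic scaling
  \<open>T\<close> in \<open>sphere_norming\<close>, and the tangential projection that homogenises
  a Taylor polynomial.\<close>

lemma hom_poly_compose_linear:
  fixes T :: "real^'m \<Rightarrow> real^'n"
  assumes "hom_poly l p" and T: "linear T"
  shows "hom_poly l (\<lambda>x. p (T x))"
  using assms(1)
proof (induction rule: hom_poly.induct)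
  case (coord l p i)
  have "linear (\<lambda>x. T x $ i)"
    using T by (simp add: linear_iff)
  from hom_poly_mult[OF hom_poly_linear_form[OF this] coord.IH] show ?case
    by simp
qed (auto intro: hom_poly.intros)

lemma hom_poly_scaleR: "hom_poly l p \<Longrightarrow> p (t *\<^sub>R x) = of_real (t ^ l) * p x"
  by (induction rule: hom_poly.induct) (auto simp: algebra_simps)

lemma hom_poly_norm_square: "hom_poly 2 (\<lambda>x. of_real (x \<bullet> x))"
proof -
  have "hom_poly 2 (\<lambda>x. \<Sum>i\<in>UNIV. of_real (x $ i) ^ 2 :: 'b)"
    by (intro hom_poly_sum) (use hom_poly_power[OF hom_poly_coord, of 2] in simp)
  then show ?thesis
    by (simp add: inner_vec_def power2_eq_square)
qed

lemma hom_poly_Hom_space: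
  assumes "hom_poly l p"
  shows "p \<in> Hom_space l"
  using assms
proof (induction rule: hom_poly.induct)
  case (const c)
  have "multi_indices 0 = {\<lambda>_::'a. 0 :: nat}"
    by (auto simp: multi_indices_def)
  then have "(\<Sum>\<alpha>\<in>multi_indices 0. c * of_real (\<Prod>i\<in>UNIV. (x $ i) ^ \<alpha> i)) = c" for x :: "real^'a"
    by (simp del: of_real_prod)
  then show ?case
    unfolding Hom_space_def mem_Collect_eq by (intro exI[of _ "\<lambda>_. c"]) metis
next
  case (zero l)
  show ?case
    by (auto simp: Hom_space_def intro!: exI[of _ "\<lambda>_. 0"])
next
  case (add l p q)
  then obtain a b where
    "p = (\<lambda>x. \<Sum>\<alpha>\<in>multi_indices l. a \<alpha> * of_real (\<Prod>i\<in>UNIV. (x $ i) ^ \<alpha> i))"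
    "q = (\<lambda>x. \<Sum>\<alpha>\<in>multi_indices l. b \<alpha> * of_real (\<Prod>i\<in>UNIV. (x $ i) ^ \<alpha> i))"
    unfolding Hom_space_def by blast
  then show ?case
    by (auto simp: Hom_space_def sum.distrib distrib_right intro!: exI[of _ "\<lambda>\<alpha>. a \<alpha> + b \<alpha>"])
next
  case (coord l p i)
  then obtain a where
    p: "p = (\<lambda>x. \<Sum>\<alpha>\<in>multi_indices l. a \<alpha> * of_real (\<Prod>i\<in>UNIV. (x $ i) ^ \<alpha> i))"
    unfolding Hom_space_def by blast
  \<comment> \<open>Multiplication by \<open>x $ i\<close> moves the coefficient at
    \<open>\<alpha>\<close> to \<open>up \<alpha>\<close>. The indices of weight
    \<open>Suc l\<close> that are not reached are those with \<open>\<alpha> i = 0\<close>, and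
    there \<open>b\<close> is 0.\<close>
  define up where "up \<alpha> = \<alpha>(i := Suc (\<alpha> i))" for \<alpha> :: "'a \<Rightarrow> nat"
  define down where "down \<alpha> = \<alpha>(i := \<alpha> i - 1)" for \<alpha> :: "'a \<Rightarrow> nat"
  define b where "b \<alpha> = (if \<alpha> i = 0 then 0 else a (down \<alpha>))" for \<alpha>
  have du: "down (up \<alpha>) = \<alpha>" for \<alpha>
    by (auto simp: up_def down_def)
  have ud: "up (down \<alpha>) = \<alpha>" if "\<alpha> i \<noteq> 0" for \<alpha>
    using that by (auto simp: up_def down_def)
  have up_mem: "up \<alpha> \<in> multi_indices (Suc l) \<longleftrightarrow> \<alpha> \<in> multi_indices l" for \<alpha>
  proof -
    have "(\<Sum>j\<in>UNIV. up \<alpha> j) = (\<Sum>j\<in>UNIV. \<alpha> j + (if j = i then 1 else 0))"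
      by (rule sum.cong) (auto simp: up_def)
    also have "\<dots> = (\<Sum>j\<in>UNIV. \<alpha> j) + 1"
      by (subst sum.distrib) simp
    finally show ?thesis by (simp add: multi_indices_def)
  qed
  have up_prod: "(\<Prod>j\<in>UNIV. (x $ j) ^ up \<alpha> j) = x $ i * (\<Prod>j\<in>UNIV. (x $ j) ^ \<alpha> j)"
    for \<alpha> and x :: "real^'a"
  proof -
    have "(\<Prod>j\<in>UNIV. (x $ j) ^ up \<alpha> j) = (\<Prod>j\<in>UNIV. (if j = i then x $ i else 1) * (x $ j) ^ \<alpha> j)"
      by (rule prod.cong) (auto simp: up_def)
    then show ?thesis
      by (simp add: prod.distrib)
  qed
  have "of_real (x $ i) * p x =
      (\<Sum>\<alpha>\<in>multi_indices (Suc l). b \<alpha> * of_real (\<Prod>i\<in>UNIV. (x $ i) ^ \<alpha> i))" for x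
  proof -
    have "(\<Sum>\<alpha>\<in>multi_indices (Suc l). b \<alpha> * of_real (\<Prod>i\<in>UNIV. (x $ i) ^ \<alpha> i)) =
        (\<Sum>\<alpha>\<in>multi_indices l. b (up \<alpha>) * of_real (\<Prod>i\<in>UNIV. (x $ i) ^ up \<alpha> i))"
    proof (rule sum.mono_neutral_cong_right[OF finite_multi_indices, THEN trans])
      show "up ` multi_indices l \<subseteq> multi_indices (Suc l)"
        using up_mem by blast
      show "\<forall>\<alpha>\<in>multi_indices (Suc l) - up ` multi_indices l.
          b \<alpha> * of_real (\<Prod>i\<in>UNIV. (x $ i) ^ \<alpha> i) = 0"
      proof
        fix \<alpha> assume \<alpha>: "\<alpha> \<in> multi_indices (Suc l) - up ` multi_indices l"
        have "\<alpha> i = 0"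
        proof (rule ccontr)
          assume "\<alpha> i \<noteq> 0"
          from \<alpha> up_mem[of "down \<alpha>"] ud[of \<alpha>, OF this] have "down \<alpha> \<in> multi_indices l" by simp
          with \<alpha> ud[of \<alpha>, OF \<open>\<alpha> i \<noteq> 0\<close>] show False by (metis DiffD2 imageI)
        qed
        then show "b \<alpha> * of_real (\<Prod>i\<in>UNIV. (x $ i) ^ \<alpha> i) = 0" by (simp add: b_def)
      qed
      have "inj_on up (multi_indices l)"
        by (metis du inj_onI)
      then show "(\<Sum>\<alpha>\<in>up ` multi_indices l. b \<alpha> * of_real (\<Prod>i\<in>UNIV. (x $ i) ^ \<alpha> i)) =
          (\<Sum>\<alpha>\<in>multi_indices l. b (up \<alpha>) * of_real (\<Prod>i\<in>UNIV. (x $ i) ^ up \<alpha> i))"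
        by (simp add: sum.reindex)
    qed auto
    also have "\<dots> = (\<Sum>\<alpha>\<in>multi_indices l. of_real (x $ i) * (a \<alpha> * of_real (\<Prod>i\<in>UNIV. (x $ i) ^ \<alpha> i)))"
    proof (rule sum.cong[OF refl])
      fix \<alpha>
      have "b (up \<alpha>) = a \<alpha>" unfolding b_def du by (simp add: up_def)
      then show "b (up \<alpha>) * of_real (\<Prod>i\<in>UNIV. (x $ i) ^ up \<alpha> i) =
          of_real (x $ i) * (a \<alpha> * of_real (\<Prod>i\<in>UNIV. (x $ i) ^ \<alpha> i))"
        by (simp only: up_prod of_real_mult mult_ac)
    qed
    finally show ?thesis by (simp add: p sum_distrib_left)
  qed
  then show ?case
    by (auto simp: Hom_space_def)
qed

text \<open>The inductive form yields products, linear substitutions and derivatives by rule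
  induction, without coefficient bookkeeping; this is its link to the coefficient form. For the
  remaining direction, a monomial is a product of coordinate powers whose degrees add up to
  \<open>l\<close>.\<close>

lemma Hom_space_iff_hom_poly: "p \<in> Hom_space l \<longleftrightarrow> hom_poly l p"
proof
  assume "p \<in> Hom_space l"
  then obtain a where
    p: "p = (\<lambda>x. \<Sum>\<alpha>\<in>multi_indices l. a \<alpha> * of_real (\<Prod>i\<in>UNIV. (x $ i) ^ \<alpha> i))"
    unfolding Hom_space_def by blast
  have *: "hom_poly (\<Sum>i\<in>A. \<alpha> i) (\<lambda>x. \<Prod>i\<in>A. of_real (x $ i) ^ \<alpha> i)"
    if "finite A" for A and \<alpha> :: "'a \<Rightarrow> nat"
    using that
  proof (induction A)
    case empty
    show ?case using hom_poly.const[of 1] by simp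
  next
    case (insert i A)
    have "hom_poly (\<alpha> i) (\<lambda>x. of_real (x $ i) ^ \<alpha> i)"
      using hom_poly_power[OF hom_poly_coord, of "\<alpha> i" i] by simp
    from hom_poly_mult[OF this insert.IH] insert.hyps show ?case by simp
  qed
  show "hom_poly l p"
    unfolding p
  proof (intro hom_poly_sum hom_poly_cmult)
    fix \<alpha> :: "'a \<Rightarrow> nat" assume "\<alpha> \<in> multi_indices l"
    then show "hom_poly l (\<lambda>x. of_real (\<Prod>i\<in>UNIV. (x $ i) ^ \<alpha> i))"
      using *[of UNIV \<alpha>] by (simp add: multi_indices_def)
  qed
qed (rule hom_poly_Hom_space)

subsection \<open>Decomposition into harmonics\<close>

lemma partial_deriv_eq:
  "(F has_derivative F') (at x) \<Longrightarrow> partial_deriv i F x = F' (axis i 1)"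
  unfolding partial_deriv_def using frechet_derivative_at by metis

lemma has_derivative_partials:
  assumes "F differentiable (at x)"
  shows "(F has_derivative (\<lambda>h. \<Sum>i\<in>UNIV. h $ i *\<^sub>R partial_deriv i F x)) (at x)"
proof -
  define F' where "F' = frechet_derivative F (at x)"
  have F': "(F has_derivative F') (at x)"
    using assms by (simp add: F'_def frechet_derivative_works)
  then have lin: "linear F'" by (rule has_derivative_linear)
  have "F' h = (\<Sum>i\<in>UNIV. h $ i *\<^sub>R partial_deriv i F x)" for h
  proof -
    have "F' h = F' (\<Sum>i\<in>UNIV. h $ i *\<^sub>R axis i 1)"
      by (simp add: basis_expansion scalar_mult_eq_scaleR[symmetric])
    then show ?thesis
      by (simp add: linear_sum[OF lin] linear_scale[OF lin] partial_deriv_def F'_def[symmetric])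
  qed
  with F' show ?thesis by (metis (no_types, lifting) ext)
qed

lemma partial_deriv_const: "partial_deriv i (\<lambda>_. c) = (\<lambda>_. 0)"
  by (rule ext, subst partial_deriv_eq) (auto intro: derivative_intros)

lemma partial_deriv_coord:
  "partial_deriv i (\<lambda>x::real^'n. of_real (x $ j) :: 'k::real_normed_field) =
    (\<lambda>_. if i = j then 1 else 0)"
proof
  fix x :: "real^'n"
  have "((\<lambda>x. of_real (x $ j) :: 'k) has_derivative (\<lambda>h. of_real (h $ j))) (at x)"
    by (rule has_derivative_of_real[OF bounded_linear_imp_has_derivative[OF bounded_linear_vec_nth]])
  from partial_deriv_eq[OF this] show "partial_deriv i (\<lambda>x. of_real (x $ j) :: 'k) x = (if i = j then 1 else 0)"
    by (auto simp: axis_def)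
qed

lemma differentiable_coord:
  "(\<lambda>x::real^'n. of_real (x $ j) :: 'k::real_normed_field) differentiable (at x)"
  unfolding differentiable_def
  using has_derivative_of_real[OF bounded_linear_imp_has_derivative[OF bounded_linear_vec_nth]]
  by blast

lemma partial_deriv_add:
  assumes "F differentiable (at x)" "G differentiable (at x)"
  shows "partial_deriv i (\<lambda>x. F x + G x) x = partial_deriv i F x + partial_deriv i G x"
proof -
  obtain F' G' where FG: "(F has_derivative F') (at x)" "(G has_derivative G') (at x)"
    using assms unfolding differentiable_def by blast
  from partial_deriv_eq[OF has_derivative_add[OF this]] show ?thesis
    by (simp add: partial_deriv_eq[OF FG(1)] partial_deriv_eq[OF FG(2)])
qed

lemma partial_deriv_mult:
  fixes F G :: "real^'n \<Rightarrow> 'k::real_normed_algebra"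
  assumes "F differentiable (at x)" "G differentiable (at x)"
  shows "partial_deriv i (\<lambda>x. F x * G x) x = F x * partial_deriv i G x + partial_deriv i F x * G x"
proof -
  obtain F' G' where FG: "(F has_derivative F') (at x)" "(G has_derivative G') (at x)"
    using assms unfolding differentiable_def by blast
  from partial_deriv_eq[OF has_derivative_mult[OF this]] show ?thesis
    by (simp add: partial_deriv_eq[OF FG(1)] partial_deriv_eq[OF FG(2)])
qed

lemma hom_poly_differentiable: "hom_poly l p \<Longrightarrow> p differentiable (at x)"
  by (induction rule: hom_poly.induct)
    (auto intro!: differentiable_add differentiable_mult differentiable_coord)

lemma hom_poly_isCont: "hom_poly l p \<Longrightarrow> isCont p x"
  using differentiable_imp_continuous_within hom_poly_differentiable by blast

lemma hom_poly_0:
  assumes "hom_poly 0 p"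
  obtains c where "p = (\<lambda>_. c)"
proof -
  have "p = (\<lambda>_. p 0)"
    using hom_poly_scaleR[OF assms, of 0] by (intro ext) (simp, metis)
  then show thesis by (rule that)
qed

lemma hom_poly_partial_deriv:
  assumes "hom_poly l p"
  shows "hom_poly (l - 1) (partial_deriv i p)"
  using assms
proof (induction rule: hom_poly.induct)
  case (coord l p j)
  have eq: "partial_deriv i (\<lambda>x. of_real (x $ j) * p x) =
      (\<lambda>x. of_real (x $ j) * partial_deriv i p x + (if i = j then 1 else 0) * p x)"
    by (rule ext, subst partial_deriv_mult)
      (auto intro: differentiable_coord hom_poly_differentiable[OF coord.hyps] simp: partial_deriv_coord)
  have "hom_poly l (\<lambda>x. of_real (x $ j) * partial_deriv i p x)"
  \<comment> \<open>The rule \<open>coord\<close> gives degree \<open>Suc (l - 1)\<close>, which is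
    \<open>l\<close> only for positive \<open>l\<close>. For \<open>l = 0\<close> the polynomial is
    constant and its derivative vanishes.\<close>
  proof (cases l)
    case 0
    with coord.hyps obtain c where "p = (\<lambda>_. c)" by (auto elim: hom_poly_0)
    then show ?thesis by (simp add: partial_deriv_const hom_poly.zero)
  next
    case (Suc m)
    then show ?thesis using hom_poly.coord[OF coord.IH, of j] by simp
  qed
  then show ?case unfolding eq
    by (auto intro: hom_poly.add hom_poly_cmult coord.hyps)
next
  case (add l p q)
  have "partial_deriv i (\<lambda>x. p x + q x) = (\<lambda>x. partial_deriv i p x + partial_deriv i q x)"
    by (intro ext partial_deriv_add) (auto intro: hom_poly_differentiable add.hyps)
  then show ?case using hom_poly.add[OF add.IH] by simp
qed (auto simp: partial_deriv_const intro: hom_poly.intros)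

lemma euler_identity:
  assumes "hom_poly l p"
  shows "(\<Sum>i\<in>UNIV. of_real (x $ i) * partial_deriv i p x) = of_nat l * p x"
  using assms
proof (induction rule: hom_poly.induct)
  case (coord l p j)
  have eq: "partial_deriv i (\<lambda>x. of_real (x $ j) * p x) x =
      of_real (x $ j) * partial_deriv i p x + (if i = j then p x else 0)" for i
    by (subst partial_deriv_mult)
      (auto intro: differentiable_coord hom_poly_differentiable[OF coord.hyps] simp: partial_deriv_coord)
  have "(\<Sum>i\<in>UNIV. of_real (x $ i) * partial_deriv i (\<lambda>x. of_real (x $ j) * p x) x)
    = of_real (x $ j) * (\<Sum>i\<in>UNIV. of_real (x $ i) * partial_deriv i p x)
      + (\<Sum>i\<in>UNIV. if i = j then of_real (x $ i) * p x else 0)"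
    unfolding eq sum_distrib_left sum.distrib[symmetric]
    by (rule sum.cong) (auto simp: algebra_simps)
  then show ?case unfolding coord.IH by (simp add: algebra_simps)
next
  case (add l p q)
  have "partial_deriv i (\<lambda>x. p x + q x) x = partial_deriv i p x + partial_deriv i q x" for i
    by (intro partial_deriv_add) (auto intro: hom_poly_differentiable add.hyps)
  then show ?case by (simp add: add.IH sum.distrib distrib_left)
qed (auto simp: partial_deriv_const)

lemma hom_poly_laplacian: "hom_poly l p \<Longrightarrow> hom_poly (l - 2) (laplacian p)"
proof -
  assume "hom_poly l p"
  from hom_poly_partial_deriv[OF hom_poly_partial_deriv[OF this]]
  have "hom_poly (l - 1 - 1) (\<lambda>x. \<Sum>i\<in>UNIV. partial_deriv i (partial_deriv i p) x)"
    by (intro hom_poly_sum)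
  then show ?thesis by (simp add: laplacian_def[abs_def] numeral_2_eq_2)
qed

lemma laplacian_low_degree: "hom_poly l p \<Longrightarrow> l < 2 \<Longrightarrow> laplacian p x = 0"
proof -
  assume p: "hom_poly l p" and l: "l < 2"
  have "partial_deriv i (partial_deriv i p) x = 0" for i
  proof -
    have "hom_poly 0 (partial_deriv i p)" 
      using hom_poly_partial_deriv[OF p, of i] l by (cases l) auto
    then obtain c where "partial_deriv i p = (\<lambda>_. c)" by (auto elim: hom_poly_0)
    then show ?thesis by (simp add: partial_deriv_const)
  qed
  then show ?thesis by (simp add: laplacian_def)
qed

lemma laplacian_diff_hom_poly:
  assumes "hom_poly l p" "hom_poly m q"
  shows "laplacian (\<lambda>x. p x - q x) x = laplacian p x - laplacian q x"
proof -
  have 1: "partial_deriv i (\<lambda>x. p x - q x) y = partial_deriv i p y - partial_deriv i q y"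
    if pq: "hom_poly l p" "hom_poly m q" for l m y and p q :: "real^'a \<Rightarrow> 'b" and i
  proof -
    obtain F' G' where FG: "(p has_derivative F') (at y)" "(q has_derivative G') (at y)"
      using hom_poly_differentiable[OF pq(1), of y, unfolded differentiable_def]
        hom_poly_differentiable[OF pq(2), of y, unfolded differentiable_def] by blast
    from partial_deriv_eq[OF has_derivative_diff[OF this]] show ?thesis
      by (simp add: partial_deriv_eq[OF FG(1)] partial_deriv_eq[OF FG(2)])
  qed
  show ?thesis
    unfolding laplacian_def sum_subtractf[symmetric]
    by (rule sum.cong[OF refl]) (simp add: 1[OF assms, abs_def]
        1[OF hom_poly_partial_deriv[OF assms(1)] hom_poly_partial_deriv[OF assms(2)]])
qed

lemma laplacian_cmult_hom_poly:
  assumes "hom_poly l p"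
  shows "laplacian (\<lambda>x. c * p x) x = c * laplacian p x"
proof -
  have 1: "partial_deriv i (\<lambda>x. c * p x) y = c * partial_deriv i p y"
    if "hom_poly l p" for l y and p :: "real^'a \<Rightarrow> 'b" and i
    using that by (subst partial_deriv_mult) (auto intro: hom_poly_differentiable simp: partial_deriv_const)
  show ?thesis
    unfolding laplacian_def sum_distrib_left
    by (rule sum.cong[OF refl]) (simp add: 1[OF assms, abs_def] 1[OF hom_poly_partial_deriv[OF assms]])
qed

lemma partial_deriv_norm_square:
  "partial_deriv i (\<lambda>x::real^'n. of_real (x \<bullet> x) :: 'k::real_normed_field) = (\<lambda>x. 2 * of_real (x $ i))"
proof
  fix x :: "real^'n"
  have "((\<lambda>x. of_real (x \<bullet> x) :: 'k) has_derivative (\<lambda>h. of_real (x \<bullet> h + h \<bullet> x))) (at x)"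
    by (auto intro!: derivative_eq_intros)
  from partial_deriv_eq[OF this] show "partial_deriv i (\<lambda>x. of_real (x \<bullet> x) :: 'k) x = 2 * of_real (x $ i)"
    by (simp add: inner_axis inner_commute)
qed

text \<open>Product rule: the Laplacian of the squared norm is twice the dimension, and the cross
  term is 4 times the radial derivative of \<open>q\<close>, which Euler's identity turns into
  \<open>4 * m * q\<close>.\<close>

lemma laplacian_norm_square_mult:
  fixes q :: "real^'n \<Rightarrow> 'k::real_normed_field"
  assumes q: "hom_poly m q"
  shows "laplacian (\<lambda>x. of_real (x \<bullet> x) * q x) x =
    of_nat (2 * (CARD('n) + 2 * m)) * q x + of_real (x \<bullet> x) * laplacian q x"
proof -
  note dq = hom_poly_differentiable[OF q] hom_poly_differentiable[OF hom_poly_partial_deriv[OF q]]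
    hom_poly_differentiable[OF hom_poly_norm_square] differentiable_coord
  have 1: "partial_deriv i (\<lambda>x. of_real (x \<bullet> x) * q x) =
      (\<lambda>x. of_real (x \<bullet> x) * partial_deriv i q x + 2 * (of_real (x $ i) * q x))" for i
    by (rule ext, subst partial_deriv_mult) (auto intro: dq simp: partial_deriv_norm_square)
  have 2: "partial_deriv i (partial_deriv i (\<lambda>x. of_real (x \<bullet> x) * q x)) x =
      of_real (x \<bullet> x) * partial_deriv i (partial_deriv i q) x
      + 4 * (of_real (x $ i) * partial_deriv i q x) + 2 * q x" for i
    unfolding 1
    apply (subst partial_deriv_add)
    apply (auto intro!: dq differentiable_mult)[2]
    apply (subst partial_deriv_mult)
    apply (auto intro!: dq differentiable_mult)[2]
    apply (subst partial_deriv_mult)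
    apply (auto intro!: dq differentiable_mult)[2]
    apply (subst partial_deriv_mult)
    apply (auto intro!: dq differentiable_mult)[2]
    apply (simp add: partial_deriv_norm_square partial_deriv_const partial_deriv_coord)
    done
  show ?thesis
    unfolding laplacian_def 2 sum.distrib sum_distrib_left[symmetric] euler_identity[OF q]
    by (simp add: algebra_simps)
qed

text \<open>If \<open>q\<close> is a solution, then \<open>t = \<Delta> q\<close> solves an equation of the same type in degree \<open>m - 2\<close>
  with a larger constant, and conversely \<open>q = (s - \<bar>x\<bar>\<^sup>2 t) / c\<close>.\<close>

lemma laplacian_equation_solvable:
  fixes s :: "real^'n \<Rightarrow> 'k::real_normed_field"
  assumes "hom_poly m s" "0 < c"
  shows "\<exists>q. hom_poly m q \<and> (\<forall>x. of_nat c * q x + of_real (x \<bullet> x) * laplacian q x = s x)"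
  using assms
proof (induction m arbitrary: s c rule: less_induct)
  case (less m)
  have c: "(of_nat c :: 'k) \<noteq> 0" using less.prems by simp
  show ?case
  proof (cases "m < 2")
    case True
    have "hom_poly m (\<lambda>x. (1 / of_nat c) * s x)"
      by (intro hom_poly_cmult less.prems)
    with True c show ?thesis
      by (intro exI[of _ "\<lambda>x. (1 / of_nat c) * s x"]) (simp add: laplacian_low_degree)
  next
    case False
    \<comment> \<open>Applying the Laplacian to \<open>c * q + (x \<bullet> x) * t = s\<close> with
      \<open>t\<close> the Laplacian of \<open>q\<close> adds the constant of
      \<open>laplacian_norm_square_mult\<close> in degree \<open>m - 2\<close> to
      \<open>c\<close>.\<close>
    define c' where "c' = c + 2 * (CARD('n) + 2 * (m - 2))"
    have "\<exists>t. hom_poly (m - 2) t \<and> (\<forall>x. of_nat c' * t x + of_real (x \<bullet> x) * laplacian t x = laplacian s x)"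
      by (rule less.IH) (use False less.prems in \<open>auto simp: c'_def intro: hom_poly_laplacian\<close>)
    then obtain t where t: "hom_poly (m - 2) t"
      and teq: "\<And>x. of_nat c' * t x + of_real (x \<bullet> x) * laplacian t x = laplacian s x" by blast
    define q where "q x = (1 / of_nat c) * (s x - of_real (x \<bullet> x) * t x)" for x
    have nt: "hom_poly m (\<lambda>x. of_real (x \<bullet> x) * t x)"
      using hom_poly_mult[OF hom_poly_norm_square t] unfolding le_add_diff_inverse[OF leI[OF False]] .
    have q: "hom_poly m q"
      unfolding q_def[abs_def] by (intro hom_poly_cmult hom_poly_diff less.prems nt)
    have "laplacian q x = t x" for x
    proof -
      have "laplacian q x = (1 / of_nat c) * (laplacian s x -
          (of_nat (2 * (CARD('n) + 2 * (m - 2))) * t x + of_real (x \<bullet> x) * laplacian t x))"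
        unfolding q_def[abs_def]
        by (subst laplacian_cmult_hom_poly[OF hom_poly_diff[OF less.prems(1) nt]],
            subst laplacian_diff_hom_poly[OF less.prems(1) nt],
            subst laplacian_norm_square_mult[OF t]) simp
      also have "\<dots> = (1 / of_nat c) * (of_nat c * t x)"
        unfolding teq[symmetric] by (simp add: c'_def algebra_simps)
      finally show ?thesis using c by simp
    qed
    then have "of_nat c * q x + of_real (x \<bullet> x) * laplacian q x = s x" for x
      using c by (simp only:) (simp add: q_def)
    then show ?thesis
      using q by blast
  qed
qed

text \<open>Factors \<open>x \<bullet> x\<close> are invisible on the sphere and raise the degree by
  2, which is where equal parity is used.\<close>

lemma hom_poly_raise_degree:
  assumes "hom_poly l p" "l \<le> L" "l mod 2 = L mod 2"
  shows "\<exists>q. hom_poly L q \<and> (\<forall>x\<in>sphere 0 1. q x = p x)"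
proof -
  obtain k where L: "L = 2 * k + l"
    using assms(2,3) by (metis add.commute mod_eq_nat2E)
  have "hom_poly L (\<lambda>x. of_real (x \<bullet> x) ^ k * p x)"
    unfolding L by (intro hom_poly_mult hom_poly_power hom_poly_norm_square assms)
  then show ?thesis
    by (auto simp: dot_square_norm intro!: exI[of _ "\<lambda>x. of_real (x \<bullet> x) ^ k * p x"])
qed

lemma hom_poly_harmonic_decomposition:
  fixes p :: "real^'n \<Rightarrow> 'k::real_normed_field"
  assumes "hom_poly L p"
  shows "\<exists>g. (\<forall>l. l \<le> L \<and> l mod 2 = L mod 2 \<longrightarrow> g l \<in> Harm_space l) \<and>
    (\<forall>x\<in>sphere 0 1. p x = (\<Sum>l\<in>{l. l \<le> L \<and> l mod 2 = L mod 2}. g l x))"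
  using assms
proof (induction L arbitrary: p rule: less_induct)
  case (less L)
  show ?case
  proof (cases "L < 2")
    case True
    have "{l. l \<le> L \<and> l mod 2 = L mod 2} = {L}"
      using True by (auto simp: less_2_cases_iff le_Suc_eq)
    moreover have "restrict p (sphere 0 1) \<in> Harm_space L"
      using less.prems laplacian_low_degree[OF less.prems True]
      by (auto simp: Harm_space_def Hom_space_iff_hom_poly)
    moreover have "l = L" if "l \<le> L \<and> l mod 2 = L mod 2" for l
      using True that by (auto simp: less_2_cases_iff le_Suc_eq)
    ultimately show ?thesis
      by (intro exI[of _ "\<lambda>_. restrict p (sphere 0 1)"] conjI allI impI ballI)
        (blast, simp del: restrict_apply add: restrict_apply')
  next
    case False
    \<comment> \<open>By \<open>laplacian_norm_square_mult\<close> this equation says exactly that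
      \<open>p - (x \<bullet> x) * q\<close> is harmonic. On the sphere that difference is
      \<open>p - q\<close>, so induction continues with \<open>q\<close>.\<close>
    have "\<exists>q. hom_poly (L - 2) q \<and> (\<forall>x. of_nat (2 * (CARD('n) + 2 * (L - 2))) * q x
        + of_real (x \<bullet> x) * laplacian q x = laplacian p x)"
      by (rule laplacian_equation_solvable[OF hom_poly_laplacian[OF less.prems]])
        (use False in simp)
    then obtain q where q: "hom_poly (L - 2) q"
      and qeq: "\<And>x. of_nat (2 * (CARD('n) + 2 * (L - 2))) * q x
        + of_real (x \<bullet> x) * laplacian q x = laplacian p x" by blast
    have nq: "hom_poly L (\<lambda>x. of_real (x \<bullet> x) * q x)"
      using hom_poly_mult[OF hom_poly_norm_square q] unfolding le_add_diff_inverse[OF leI[OF False]] .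
    define u where "u x = p x - of_real (x \<bullet> x) * q x" for x
    have u: "hom_poly L u"
      unfolding u_def[abs_def] by (intro hom_poly_diff less.prems nq)
    have "laplacian u x = 0" for x
      using qeq[of x] unfolding u_def[abs_def] laplacian_diff_hom_poly[OF less.prems nq]
        laplacian_norm_square_mult[OF q] by (simp only: diff_self)
    with u have uH: "restrict u (sphere 0 1) \<in> Harm_space L"
      unfolding Harm_space_def Hom_space_iff_hom_poly by blast
    obtain g where g: "\<And>l. l \<le> L - 2 \<and> l mod 2 = (L - 2) mod 2 \<Longrightarrow> g l \<in> Harm_space l"
      and gs: "\<And>x. x \<in> sphere 0 1 \<Longrightarrow>
        q x = (\<Sum>l\<in>{l. l \<le> L - 2 \<and> l mod 2 = (L - 2) mod 2}. g l x)"
    proof -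
      have "L - 2 < L" using False by simp
      from less.IH[OF this q] show thesis using that by (elim exE conjE) blast
    qed
    have set_eq: "{l. l \<le> L \<and> l mod 2 = L mod 2} =
        insert L {l. l \<le> L - 2 \<and> l mod 2 = (L - 2) mod 2}"
    proof -
      have "l \<le> L \<and> l mod 2 = L mod 2 \<longleftrightarrow> l = L \<or> l \<le> L - 2 \<and> l mod 2 = (L - 2) mod 2" for l
      proof -
        obtain k where L: "L = Suc (Suc k)"
          using False by (metis add_2_eq_Suc le_add_diff_inverse not_less)
        have "l \<le> L \<longleftrightarrow> l = L \<or> l = Suc k \<or> l \<le> k" by (auto simp: L)
        moreover have "Suc k mod 2 \<noteq> L mod 2" by (simp add: L mod_Suc)
        ultimately show ?thesis by (auto simp: L)
      qed
      then show ?thesis by blast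
    qed
    have L: "L \<notin> {l. l \<le> L - 2 \<and> l mod 2 = (L - 2) mod 2}"
      using False by auto
    show ?thesis
    proof (intro exI[of _ "g(L := restrict u (sphere 0 1))"] conjI allI ballI impI)
      fix l assume "l \<le> L \<and> l mod 2 = L mod 2"
      then have "l = L \<or> l \<le> L - 2 \<and> l mod 2 = (L - 2) mod 2"
        using set_eq by blast
      then show "(g(L := restrict u (sphere 0 1))) l \<in> Harm_space l"
        using uH g by auto
    next
      fix x :: "real^'n" assume x: "x \<in> sphere 0 1"
      have "(\<Sum>l\<in>{l. l \<le> L \<and> l mod 2 = L mod 2}. (g(L := restrict u (sphere 0 1))) l x)
        = u x + (\<Sum>l\<in>{l. l \<le> L - 2 \<and> l mod 2 = (L - 2) mod 2}. (g(L := restrict u (sphere 0 1))) l x)"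
        unfolding set_eq using L x by (subst sum.insert) auto
      also have "\<dots> = u x + q x"
        unfolding gs[OF x] using L by (intro arg_cong2[where f="(+)"] refl sum.cong) auto
      also have "\<dots> = p x"
        using x by (simp add: u_def dot_square_norm)
      finally show "p x = (\<Sum>l\<in>{l. l \<le> L \<and> l mod 2 = L mod 2}.
          (g(L := restrict u (sphere 0 1))) l x)" by simp
    qed
  qed
qed

lemma H2_space_eq: "H2_space L = {restrict p (sphere 0 1) | p. hom_poly L p}"
proof (intro equalityI subsetI)
  fix v :: "real^'n \<Rightarrow> 'k::real_normed_field"
  let ?I = "{l. l \<le> L \<and> l mod 2 = L mod 2}"
  assume "v \<in> H2_space L"
  then obtain g where v: "v = restrict (\<lambda>x. \<Sum>l\<in>?I. g l x) (sphere 0 1)"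
    and g: "\<And>l. l \<in> ?I \<Longrightarrow> g l \<in> Harm_space l"
    unfolding H2_space_def by blast
  have "\<exists>q. hom_poly L q \<and> (\<forall>x\<in>sphere 0 1. q x = g l x)" if l: "l \<in> ?I" for l
  proof -
    from g[OF l] obtain p where "g l = restrict p (sphere 0 1)" "hom_poly l p"
      by (auto simp: Harm_space_def Hom_space_iff_hom_poly)
    with hom_poly_raise_degree[of l p L] l show ?thesis by auto
  qed
  then have "\<forall>l\<in>?I. \<exists>q. hom_poly L q \<and> (\<forall>x\<in>sphere 0 1. q x = g l x)" by blast
  from bchoice[OF this] obtain q where q: "\<And>l. l \<in> ?I \<Longrightarrow> hom_poly L (q l)"
    "\<And>l x. l \<in> ?I \<Longrightarrow> x \<in> sphere 0 1 \<Longrightarrow> q l x = g l x" by blast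
  have "v = restrict (\<lambda>x. \<Sum>l\<in>?I. q l x) (sphere 0 1)"
    unfolding v using q(2) by (intro restrict_ext sum.cong) auto
  moreover have "hom_poly L (\<lambda>x. \<Sum>l\<in>?I. q l x)"
    by (intro hom_poly_sum q(1))
  ultimately show "v \<in> {restrict p (sphere 0 1) | p. hom_poly L p}" by blast
next
  fix v :: "real^'n \<Rightarrow> 'k::real_normed_field"
  assume "v \<in> {restrict p (sphere 0 1) | p. hom_poly L p}"
  then obtain p where v: "v = restrict p (sphere 0 1)" and p: "hom_poly L p" by blast
  from hom_poly_harmonic_decomposition[OF p] obtain g where
    g: "\<forall>l. l \<le> L \<and> l mod 2 = L mod 2 \<longrightarrow> g l \<in> Harm_space l"
    "\<forall>x\<in>sphere 0 1. p x = (\<Sum>l\<in>{l. l \<le> L \<and> l mod 2 = L mod 2}. g l x)" by blast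
  have "v = restrict (\<lambda>x. \<Sum>l\<in>{l. l \<le> L \<and> l mod 2 = L mod 2}. g l x) (sphere 0 1)"
    unfolding v using g(2) by (intro restrict_ext) auto
  with g(1) show "v \<in> H2_space L" unfolding H2_space_def by blast
qed

subsection \<open>Norming sets\<close>

text \<open>Elimination on function values. The residual \<open>g\<close> of the new function
  \<open>b j\<close> after interpolation on \<open>X\<close> either vanishes on \<open>A\<close>,
  and nothing changes, or is nonzero at some \<open>a\<close>. Then \<open>a\<close> becomes a node,
  \<open>g\<close> scaled to value 1 at \<open>a\<close> becomes its basis function, and multiples
  of it are subtracted from the old basis functions to make them vanish at \<open>a\<close>. Linear
  independence of the \<open>b i\<close> is never assumed.\<close>

lemma lagrange_basis:
  fixes b :: "'i \<Rightarrow> 'a \<Rightarrow> 'k::field"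
  assumes "finite I"
  shows "\<exists>X f. finite X \<and> X \<subseteq> A \<and>
    (\<forall>x\<in>X. \<exists>c. \<forall>z. f x z = (\<Sum>i\<in>I. c i * b i z)) \<and>
    (\<forall>x\<in>X. \<forall>y\<in>X. f x y = (if x = y then 1 else 0)) \<and>
    (\<forall>c. \<forall>z\<in>A. (\<Sum>i\<in>I. c i * b i z) = (\<Sum>x\<in>X. (\<Sum>i\<in>I. c i * b i x) * f x z))"
  using assms
proof (induction I)
  case empty
  show ?case by (intro exI[of _ "{}"]) auto
next
  case (insert j I)
  from insert.IH obtain X f where X: "finite X" "X \<subseteq> A"
    and f_span: "\<forall>x\<in>X. \<exists>c. \<forall>z. f x z = (\<Sum>i\<in>I. c i * b i z)"
    and f_delta: "\<forall>x\<in>X. \<forall>y\<in>X. f x y = (if x = y then 1 else 0)"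
    and f_eq: "\<forall>c. \<forall>z\<in>A. (\<Sum>i\<in>I. c i * b i z) = (\<Sum>x\<in>X. (\<Sum>i\<in>I. c i * b i x) * f x z)"
    by (elim exE conjE) (rule that)
  define spn where "spn I h \<longleftrightarrow> (\<exists>c. \<forall>z. h z = (\<Sum>i\<in>I. c i * b i z))" for I and h :: "'a \<Rightarrow> 'k"
  have spn_add: "spn J (\<lambda>z. h z + h' z)" if "spn J h" "spn J h'" for J h h'
  proof -
    from that obtain c c' where "\<forall>z. h z = (\<Sum>i\<in>J. c i * b i z)" "\<forall>z. h' z = (\<Sum>i\<in>J. c' i * b i z)"
      unfolding spn_def by blast
    then show ?thesis unfolding spn_def
      by (intro exI[of _ "\<lambda>i. c i + c' i"]) (simp add: distrib_right sum.distrib)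
  qed
  have spn_cmult: "spn J (\<lambda>z. d * h z)" if "spn J h" for J h d
  proof -
    from that obtain c where "\<forall>z. h z = (\<Sum>i\<in>J. c i * b i z)"
      unfolding spn_def by blast
    then show ?thesis unfolding spn_def
      by (intro exI[of _ "\<lambda>i. d * c i"]) (simp add: sum_distrib_left mult.assoc)
  qed
  have spn_mono: "spn (insert j I) h" if "spn I h" for h
  proof -
    from that obtain c where c: "\<forall>z. h z = (\<Sum>i\<in>I. c i * b i z)"
      unfolding spn_def by blast
    have "(\<Sum>i\<in>I. (if i = j then 0 else c i) * b i z) = (\<Sum>i\<in>I. c i * b i z)" for z
      using insert.hyps by (intro sum.cong) auto
    then show ?thesis unfolding spn_def
      using c insert.hyps by (intro exI[of _ "\<lambda>i. if i = j then 0 else c i"]) simp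
  qed
  have spn_b: "spn (insert j I) (b j)"
  proof -
    have "(\<Sum>i\<in>I. (if i = j then 1 else 0) * b i z) = 0" for z
      using insert.hyps by (intro sum.neutral) auto
    then show ?thesis unfolding spn_def
      using insert.hyps by (intro exI[of _ "\<lambda>i. if i = j then 1 else 0"]) simp
  qed
  have spn_0: "spn J (\<lambda>_. 0)" for J
    unfolding spn_def by (intro exI[of _ "\<lambda>_. 0"]) simp
  have spn_sum: "spn J (\<lambda>z. \<Sum>x\<in>B. h x z)" if "\<And>x. x \<in> B \<Longrightarrow> spn J (h x)" for B J and h :: "'a \<Rightarrow> _"
    using that by (induction B rule: infinite_finite_induct) (auto intro: spn_add spn_0)
  have spn_f: "spn (insert j I) (f x)" if "x \<in> X" for x
    using f_span that by (intro spn_mono) (simp add: spn_def)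
  define g where "g z = b j z - (\<Sum>x\<in>X. b j x * f x z)" for z
  have g_span: "spn (insert j I) g"
  proof -
    have "spn (insert j I) (\<lambda>z. b j z + (-1) * (\<Sum>x\<in>X. b j x * f x z))"
      by (intro spn_add spn_b spn_cmult spn_sum spn_f)
    then show ?thesis by (simp add: g_def[abs_def])
  qed
  have g_X: "g y = 0" if "y \<in> X" for y
  proof -
    have "(\<Sum>x\<in>X. b j x * f x y) = (\<Sum>x\<in>X. if x = y then b j x else 0)"
      using that by (intro sum.cong) (auto simp: f_delta)
    then show ?thesis using that X by (simp add: g_def)
  qed
  have decomp: "(\<Sum>i\<in>insert j I. c i * b i z) =
      (\<Sum>x\<in>X. (\<Sum>i\<in>insert j I. c i * b i x) * f x z) + c j * g z" if z: "z \<in> A" for c z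
  proof -
    have "(\<Sum>x\<in>X. (\<Sum>i\<in>insert j I. c i * b i x) * f x z) =
        (\<Sum>x\<in>X. (\<Sum>i\<in>I. c i * b i x) * f x z) + c j * (\<Sum>x\<in>X. b j x * f x z)"
      using insert.hyps by (simp add: sum_distrib_left sum.distrib[symmetric] algebra_simps)
    then show ?thesis
      using insert.hyps f_eq[rule_format, OF z, of c] by (simp add: g_def algebra_simps)
  qed
  show ?case
  proof (cases "\<exists>a\<in>A. g a \<noteq> 0")
    case False
    show ?thesis
    proof (intro exI[of _ X] exI[of _ f] conjI allI ballI)
      fix c z assume z: "z \<in> A"
      with False have "g z = 0" by blast
      with decomp[OF z, of c] show "(\<Sum>i\<in>insert j I. c i * b i z) =
          (\<Sum>x\<in>X. (\<Sum>i\<in>insert j I. c i * b i x) * f x z)" by simp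
    qed (use X f_delta spn_f in \<open>auto simp: spn_def\<close>)
  next
    case True
    then obtain a where a: "a \<in> A" "g a \<noteq> 0" by blast
    then have aX: "a \<notin> X" using g_X by blast
    define e where "e z = 1 / g a * g z" for z
    define f' where "f' x z = (if x = a then e z else f x z + (- f x a) * e z)" for x z
    have e_span: "spn (insert j I) e"
      unfolding e_def[abs_def] by (intro spn_cmult g_span)
    have e_X: "e y = 0" if "y \<in> X" for y using g_X[OF that] by (simp add: e_def)
    have e_a: "e a = 1" using a by (simp add: e_def)
    show ?thesis
    proof (intro exI[of _ "insert a X"] exI[of _ f'] conjI allI ballI)
      fix x assume "x \<in> insert a X"
      then have "spn (insert j I) (f' x)"
      proof (cases "x = a")
        case True
        then show ?thesis using e_span by (simp add: f'_def[abs_def])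
      next
        case False
        with \<open>x \<in> insert a X\<close> have "spn (insert j I) (\<lambda>z. f x z + (- f x a) * e z)"
          by (intro spn_add spn_cmult e_span spn_f) simp
        moreover have "f' x = (\<lambda>z. f x z + (- f x a) * e z)"
          using False by (simp add: f'_def[abs_def])
        ultimately show ?thesis by simp
      qed
      then show "\<exists>c. \<forall>z. f' x z = (\<Sum>i\<in>insert j I. c i * b i z)" by (simp add: spn_def)
    next
      fix x y assume "x \<in> insert a X" "y \<in> insert a X"
      then show "f' x y = (if x = y then 1 else 0)"
        using aX f_delta e_X e_a by (auto simp: f'_def)
    next
      fix c z assume z: "z \<in> A"
      define p where "p z = (\<Sum>i\<in>insert j I. c i * b i z)" for z
      have pz: "p z = (\<Sum>x\<in>X. p x * f x z) + c j * g z" if "z \<in> A" for z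
        using decomp[OF that, of c] by (simp add: p_def)
      have "(\<Sum>x\<in>insert a X. p x * f' x z) = p a * e z + (\<Sum>x\<in>X. p x * f' x z)"
        using aX X by (simp add: f'_def)
      also have "(\<Sum>x\<in>X. p x * f' x z) = (\<Sum>x\<in>X. p x * f x z - (p x * f x a) * e z)"
        using aX by (intro sum.cong) (auto simp: f'_def algebra_simps)
      also have "\<dots> = (\<Sum>x\<in>X. p x * f x z) - (\<Sum>x\<in>X. p x * f x a) * e z"
        by (simp add: sum_subtractf sum_distrib_right)
      also have "p a * e z + \<dots> = (\<Sum>x\<in>X. p x * f x z) + (p a - (\<Sum>x\<in>X. p x * f x a)) * e z"
        by (simp add: algebra_simps)
      also have "(p a - (\<Sum>x\<in>X. p x * f x a)) * e z = c j * g z"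
        using pz[OF a(1)] a(2) by (simp add: e_def)
      finally show "(\<Sum>i\<in>insert j I. c i * b i z) =
          (\<Sum>x\<in>insert a X. (\<Sum>i\<in>insert j I. c i * b i x) * f' x z)"
        using pz[OF z] by (simp add: p_def)
    qed (use X a in auto)
  qed
qed

lemma hom_poly_lagrange:
  fixes A :: "(real^'n) set"
  obtains X and f :: "real^'n \<Rightarrow> real^'n \<Rightarrow> 'k::real_normed_field"
  where "finite X" "X \<subseteq> A" "\<And>x. x \<in> X \<Longrightarrow> hom_poly L (f x)"
    "\<And>p z. hom_poly L p \<Longrightarrow> z \<in> A \<Longrightarrow> p z = (\<Sum>x\<in>X. p x * f x z)"
proof -
  define b where "b \<alpha> x = (of_real (\<Prod>i\<in>UNIV. (x $ i) ^ \<alpha> i) :: 'k)" for \<alpha> and x :: "real^'n"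
  have hp: "hom_poly L p \<longleftrightarrow> (\<exists>c. \<forall>z. p z = (\<Sum>\<alpha>\<in>multi_indices L. c \<alpha> * b \<alpha> z))"
    for p :: "real^'n \<Rightarrow> 'k"
    by (simp add: Hom_space_iff_hom_poly[symmetric] Hom_space_def b_def fun_eq_iff)
  obtain X and f :: "real^'n \<Rightarrow> real^'n \<Rightarrow> 'k" where *: "finite X" "X \<subseteq> A"
    "\<forall>x\<in>X. \<exists>c. \<forall>z. f x z = (\<Sum>\<alpha>\<in>multi_indices L. c \<alpha> * b \<alpha> z)"
    "\<forall>c. \<forall>z\<in>A. (\<Sum>\<alpha>\<in>multi_indices L. c \<alpha> * b \<alpha> z) =
       (\<Sum>x\<in>X. (\<Sum>\<alpha>\<in>multi_indices L. c \<alpha> * b \<alpha> x) * f x z)"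
    using lagrange_basis[OF finite_multi_indices[of L], where b = b and A = A]
    by (elim exE conjE) (rule that)
  show thesis
  proof (rule that[of X f])
    show "hom_poly L (f x)" if "x \<in> X" for x
      using *(3) that by (simp add: hp)
    fix p :: "real^'n \<Rightarrow> 'k" and z assume "hom_poly L p" and z: "z \<in> A"
    then obtain c where "\<And>z. p z = (\<Sum>\<alpha>\<in>multi_indices L. c \<alpha> * b \<alpha> z)" using hp by blast
    with *(4) z show "p z = (\<Sum>x\<in>X. p x * f x z)" by simp
  qed (use * in simp_all)
qed

section \<open>Homogeneous polynomials are determined on a disc in a tangent plane\<close>

lemma hom_poly_on_line:
  fixes p :: "real^'n \<Rightarrow> 'k::real_normed_field"
  assumes "hom_poly l p"
  shows "\<exists>P. \<forall>t. p (a + t *\<^sub>R b) = poly P (of_real t)"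
  using assms
proof (induction rule: hom_poly.induct)
  case (const c)
  show ?case by (intro exI[of _ "[:c:]"]) simp
next
  case (zero l)
  show ?case by (intro exI[of _ 0]) simp
next
  case (coord l p i)
  then obtain P where "\<forall>t. p (a + t *\<^sub>R b) = poly P (of_real t)" by blast
  then show ?case
    by (intro exI[of _ "[:of_real (a $ i), of_real (b $ i):] * P"]) (simp add: algebra_simps)
next
  case (add l p q)
  then obtain P Q where "\<forall>t. p (a + t *\<^sub>R b) = poly P (of_real t)"
    "\<forall>t. q (a + t *\<^sub>R b) = poly Q (of_real t)" by blast
  then show ?case by (intro exI[of _ "P + Q"]) simp
qed

text \<open>Every point near \<open>e\<close> is a positive multiple of a point of the disc, so by
  homogeneity \<open>p\<close> vanishes on the line through \<open>e\<close> and \<open>x\<close>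
  close to \<open>e\<close>. There \<open>p\<close> is a polynomial in one variable with infinitely
  many roots, hence zero, also at parameter 1.\<close>

lemma hom_poly_vanishing:
  fixes p :: "real^'n \<Rightarrow> 'k::real_normed_field"
  assumes p: "hom_poly l p" and e: "norm e = 1" and "0 < r"
    and van: "\<And>v. v \<bullet> e = 0 \<Longrightarrow> norm v \<le> r \<Longrightarrow> p (e + v) = 0"
  shows "p x = 0"
proof -
  define s where "s t = (e + t *\<^sub>R (x - e)) \<bullet> e" for t
  have s: "isCont s 0" "s 0 = 1"
    unfolding s_def using e by (auto intro!: continuous_intros simp: dot_square_norm)
  have "((\<lambda>t. (e + t *\<^sub>R (x - e)) /\<^sub>R s t - e) \<longlongrightarrow> (e + 0 *\<^sub>R (x - e)) /\<^sub>R s 0 - e) (at 0)"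
    using s unfolding isCont_def by (intro tendsto_intros) auto
  then have "((\<lambda>t. (e + t *\<^sub>R (x - e)) /\<^sub>R s t - e) \<longlongrightarrow> 0) (at 0)"
    using s by simp
  from tendstoD[OF this \<open>0 < r\<close>]
  have 1: "\<forall>\<^sub>F t in at 0. norm ((e + t *\<^sub>R (x - e)) /\<^sub>R s t - e) < r" by (simp add: dist_norm)
  have 2: "\<forall>\<^sub>F t in at 0. s t > 0"
    using s order_tendstoD(1)[of s "s 0" "at 0" 0] unfolding isCont_def by simp
  have "\<forall>\<^sub>F t in at 0. p (e + t *\<^sub>R (x - e)) = 0"
    using 1 2
  proof eventually_elim
    case (elim t)
    define v where "v = (e + t *\<^sub>R (x - e)) /\<^sub>R s t - e"
    have "v \<bullet> e = 0"
      using elim e by (simp add: v_def inner_diff_left dot_square_norm s_def[symmetric])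
    with elim have "p (e + v) = 0" by (intro van) (auto simp: v_def)
    moreover have "e + t *\<^sub>R (x - e) = s t *\<^sub>R (e + v)" using elim by (simp add: v_def)
    ultimately show ?case using hom_poly_scaleR[OF p, of "s t" "e + v"] by simp
  qed
  then obtain d where d: "d > 0" "\<And>t. t \<noteq> 0 \<Longrightarrow> \<bar>t\<bar> < d \<Longrightarrow> p (e + t *\<^sub>R (x - e)) = 0"
    unfolding eventually_at by (auto simp: dist_real_def)
  obtain P where P: "\<And>t. p (e + t *\<^sub>R (x - e)) = poly P (of_real t)"
    using hom_poly_on_line[OF p, of e "x - e"] by blast
  have "P = 0"
  proof (rule ccontr)
    assume "P \<noteq> 0"
    then have "finite {z. poly P z = 0}" by (rule poly_roots_finite)
    moreover have "of_real ` {0<..<d} \<subseteq> {z. poly P z = 0}" using d P by auto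
    ultimately have "finite (of_real ` {0<..<d} :: 'k set)" by (rule rev_finite_subset)
    then have "finite {0<..<d}" by (rule finite_imageD) (auto intro: inj_onI)
    then show False using infinite_Ioo[OF d(1)] by blast
  qed
  with P[of 1] show ?thesis by simp
qed

text \<open>The Lagrange points \<open>X\<close> of the disc determine \<open>p\<close> on the disc
  and thus everywhere. Their exact position is not essential: if \<open>m\<close> is the maximum of
  \<open>norm (p x)\<close> on \<open>X\<close>, then moving a point by less than
  \<open>\<epsilon>\<close> changes \<open>p\<close> by at most \<open>m / 2\<close>, so values at
  nearby points \<open>\<beta> x\<close> control \<open>m\<close>.\<close>

lemma hom_poly_norming:
  assumes e: "norm (e::real^'n) = 1" and "0 < r"
  obtains X and \<epsilon> C :: real where "finite X" "0 < \<epsilon>" "0 \<le> C"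
    "\<And>x. x \<in> X \<Longrightarrow> (x - e) \<bullet> e = 0 \<and> norm (x - e) \<le> r"
    "\<And>(p :: real^'n \<Rightarrow> 'k::real_normed_field) \<beta> M. hom_poly L p \<Longrightarrow>
      (\<And>x. x \<in> X \<Longrightarrow> norm (\<beta> x - x) < \<epsilon> \<and> norm (p (\<beta> x)) \<le> M) \<Longrightarrow>
      norm (p e) \<le> C * M \<and> (M = 0 \<longrightarrow> (\<forall>z. p z = 0))"
proof -
  define A where "A = {x. (x - e) \<bullet> e = 0 \<and> norm (x - e) \<le> r}"
  obtain X and f :: "real^'n \<Rightarrow> real^'n \<Rightarrow> 'k" where X: "finite X" "X \<subseteq> A"
    and f: "\<And>x. x \<in> X \<Longrightarrow> hom_poly L (f x)"
    and A: "\<And>p z. hom_poly L p \<Longrightarrow> z \<in> A \<Longrightarrow> p z = (\<Sum>x\<in>X. p x * f x z)"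
    using hom_poly_lagrange[of A L] by blast
  have all: "p z = (\<Sum>x\<in>X. p x * f x z)" if p: "hom_poly L p" for p z
  proof -
    have "hom_poly L (\<lambda>z. p z - (\<Sum>x\<in>X. p x * f x z))"
      by (intro hom_poly_diff hom_poly_sum hom_poly_cmult p f)
    from hom_poly_vanishing[OF this e \<open>0 < r\<close>, of z] A[OF p] show ?thesis
      by (simp add: A_def)
  qed
  \<comment> \<open>Oscillation of all Lagrange functions between \<open>x\<close> and
    \<open>z\<close>. Keeping it below 1/2 lets the term \<open>m / 2\<close> be absorbed on the
    left.\<close>
  define h where "h x z = (\<Sum>a\<in>X. norm (f a x - f a z))" for x z
  have "\<exists>\<epsilon>>0. \<forall>z. norm (z - x) < \<epsilon> \<longrightarrow> h x z < 1 / 2" if "x \<in> X" for x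
  proof -
    have "isCont (h x) x"
      unfolding h_def by (intro continuous_intros hom_poly_isCont[OF f])
    moreover have "h x x = 0" by (simp add: h_def)
    ultimately have "(h x \<longlongrightarrow> 0) (nhds x)"
      unfolding isCont_def tendsto_at_iff_tendsto_nhds by metis
    then have "\<forall>\<^sub>F z in nhds x. h x z < 1 / 2"
      by (rule order_tendstoD(2)) simp
    then show ?thesis unfolding eventually_nhds_metric by (auto simp: dist_norm)
  qed
  then obtain \<epsilon>' where \<epsilon>': "\<And>x. x \<in> X \<Longrightarrow> 0 < \<epsilon>' x"
    "\<And>x z. x \<in> X \<Longrightarrow> norm (z - x) < \<epsilon>' x \<Longrightarrow> h x z < 1 / 2" by metis
  define \<epsilon> where "\<epsilon> = Min (insert 1 (\<epsilon>' ` X))"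
  have \<epsilon>: "0 < \<epsilon>" "\<And>x. x \<in> X \<Longrightarrow> \<epsilon> \<le> \<epsilon>' x"
    using X(1) \<epsilon>'(1) by (auto simp: \<epsilon>_def)
  \<comment> \<open>The factor 2 is lost between the perturbed points and \<open>X\<close>; the sum
    is the Lebesgue function of the interpolation at \<open>e\<close>.\<close>
  define C where "C = 2 * (\<Sum>x\<in>X. norm (f x e))"
  show thesis
  proof (rule that[of X \<epsilon> C])
    show "0 \<le> C" by (simp add: C_def sum_nonneg)
    show "(x - e) \<bullet> e = 0 \<and> norm (x - e) \<le> r" if "x \<in> X" for x
      using that X(2) by (auto simp: A_def)
    fix p :: "real^'n \<Rightarrow> 'k" and \<beta> M
    assume p: "hom_poly L p"
      and \<beta>: "\<And>x. x \<in> X \<Longrightarrow> norm (\<beta> x - x) < \<epsilon> \<and> norm (p (\<beta> x)) \<le> M"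
    have pX: "norm (p x) \<le> 2 * M" if "x \<in> X" for x
    proof -
      define m where "m = Max ((\<lambda>x. norm (p x)) ` X)"
      have m: "norm (p a) \<le> m" if "a \<in> X" for a
        unfolding m_def using X(1) that by (intro Max_ge) auto
      have "m \<in> (\<lambda>x. norm (p x)) ` X"
        unfolding m_def using X(1) that by (intro Max_in) auto
      then obtain a where a: "a \<in> X" "m = norm (p a)" by blast
      have "p a - p (\<beta> a) = (\<Sum>x\<in>X. p x * (f x a - f x (\<beta> a)))"
        by (subst all[OF p, of a], subst all[OF p, of "\<beta> a"])
          (simp add: sum_subtractf[symmetric] right_diff_distrib)
      also have "norm \<dots> \<le> (\<Sum>x\<in>X. m * norm (f x a - f x (\<beta> a)))"
        by (rule sum_norm_le) (auto simp: norm_mult intro!: mult_right_mono m)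
      also have "\<dots> = m * h a (\<beta> a)" by (simp add: h_def sum_distrib_left)
      also have "\<dots> \<le> m * (1 / 2)"
      proof (rule mult_left_mono)
        have "norm (\<beta> a - a) < \<epsilon>' a" using \<beta>[OF a(1)] \<epsilon>(2)[OF a(1)] by simp
        then show "h a (\<beta> a) \<le> 1 / 2" using \<epsilon>'(2)[OF a(1)] by (meson less_imp_le)
        show "0 \<le> m" using a by simp
      qed
      finally have "norm (p a) \<le> norm (p (\<beta> a)) + m / 2"
        using norm_triangle_ineq2[of "p a" "p (\<beta> a)"] by simp
      with \<beta>[OF a(1)] a(2) have "m \<le> 2 * M" by simp
      with m[OF that] show ?thesis by simp
    qed
    have "norm (p e) \<le> (\<Sum>x\<in>X. 2 * M * norm (f x e))"
      by (subst all[OF p], rule sum_norm_le) (auto simp: norm_mult intro!: mult_right_mono pX)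
    then have "norm (p e) \<le> C * M" by (simp add: C_def sum_distrib_left mult_ac)
    moreover have "p z = 0" if "M = 0" for z
      using pX that by (subst all[OF p]) (auto intro!: sum.neutral)
    ultimately show "norm (p e) \<le> C * M \<and> (M = 0 \<longrightarrow> (\<forall>z. p z = 0))" by blast
  qed (use X \<epsilon> in auto)
qed

section \<open>Central projection and transport of the norming estimate to the sphere\<close>

lemma inner_unit_eq:
  assumes "norm x = 1" "norm y = 1"
  shows "x \<bullet> y = 1 - (norm (x - y))\<^sup>2 / 2"
  using assms by (simp add: power2_norm_eq_inner inner_diff_left inner_diff_right inner_commute
      norm_eq_1 field_simps)

text \<open>The map \<open>z /\<^sub>R (z \<bullet> y)\<close> is central projection onto the
  tangent plane at \<open>y\<close>. The common denominator is at least 1/4 and the numerator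
  consists of two terms of size at most \<open>norm (z - x)\<close>, whence 8.\<close>

lemma central_projection_lipschitz:
  fixes x z y :: "'a::real_inner"
  assumes "norm x = 1" "norm z = 1" "norm y = 1" "1 / 2 \<le> x \<bullet> y" "1 / 2 \<le> z \<bullet> y"
  shows "norm (z /\<^sub>R (z \<bullet> y) - x /\<^sub>R (x \<bullet> y)) \<le> 8 * norm (z - x)"
proof -
  have "z /\<^sub>R (z \<bullet> y) - x /\<^sub>R (x \<bullet> y) =
      (1 / ((z \<bullet> y) * (x \<bullet> y))) *\<^sub>R ((x \<bullet> y) *\<^sub>R (z - x) - ((z - x) \<bullet> y) *\<^sub>R x)"
    using assms by (simp add: algebra_simps inner_diff_left divide_simps)
  also have "norm \<dots> \<le> 4 * (norm (z - x) + norm (z - x))"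
    unfolding norm_scaleR
  proof (rule mult_mono)
    have "1 / 2 * (1 / 2) \<le> (z \<bullet> y) * (x \<bullet> y)"
      using assms by (intro mult_mono) auto
    then show "\<bar>1 / ((z \<bullet> y) * (x \<bullet> y))\<bar> \<le> 4" by (simp add: divide_simps)
    have "\<bar>x \<bullet> y\<bar> \<le> 1" "\<bar>(z - x) \<bullet> y\<bar> \<le> norm (z - x)"
      using Cauchy_Schwarz_ineq2[of x y] Cauchy_Schwarz_ineq2[of "z - x" y] assms by auto
    then have "\<bar>x \<bullet> y\<bar> * norm (z - x) + \<bar>(z - x) \<bullet> y\<bar> * norm x \<le> 1 * norm (z - x) + norm (z - x) * 1"
      using assms by (intro add_mono mult_mono) auto
    then show "norm ((x \<bullet> y) *\<^sub>R (z - x) - ((z - x) \<bullet> y) *\<^sub>R x) \<le> norm (z - x) + norm (z - x)"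
      using norm_triangle_ineq4[of "(x \<bullet> y) *\<^sub>R (z - x)" "((z - x) \<bullet> y) *\<^sub>R x"] by simp
  qed auto
  finally show ?thesis by simp
qed

text \<open>Near \<open>y\<close> the sphere is parametrised by \<open>v \<mapsto> T (e + v) / \<bar>T (e + v)\<bar>\<close> for \<open>v\<close> orthogonal to \<open>e\<close>,
  where the linear map \<open>T\<close> sends \<open>e\<close> to \<open>y\<close> and scales the orthogonal complement of \<open>e\<close> by \<open>\<delta>\<close>.
  Homogeneous polynomials are invariant under \<open>T\<close>, so the constants depend neither on \<open>y\<close> nor on \<open>\<delta>\<close>.\<close>

lemma sphere_norming:
  obtains \<eta> C :: real where "0 < \<eta>" "0 \<le> C"
    "\<And>(p :: real^'n \<Rightarrow> 'k::real_normed_field) Y \<delta> y M. hom_poly L p \<Longrightarrow> Y \<subseteq> sphere 0 1 \<Longrightarrow>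
      0 < \<delta> \<Longrightarrow> \<delta> \<le> 1 \<Longrightarrow> y \<in> sphere 0 1 \<Longrightarrow>
      (\<And>x. x \<in> sphere 0 1 \<Longrightarrow> \<exists>z\<in>Y. norm (z - x) \<le> \<eta> * \<delta>) \<Longrightarrow>
      (\<And>z. z \<in> Y \<Longrightarrow> norm (z - y) \<le> \<delta> / 8 \<Longrightarrow> norm (p z) \<le> M) \<Longrightarrow>
      norm (p y) \<le> C * M \<and> (M = 0 \<longrightarrow> (\<forall>z. p z = 0))"
proof -
  obtain i0 :: 'n where True by blast
  define e :: "real^'n" where "e = axis i0 1"
  have e: "norm e = 1" by (simp add: e_def)
  \<comment> \<open>With radius 1/32 the image \<open>t\<close> of a norming point is within
    \<open>\<delta> / 32\<close> of \<open>y\<close>, and its radial projection \<open>\<xi>\<close>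
    within \<open>\<delta> / 16\<close>. A node within \<open>\<delta> / 16\<close> of
    \<open>\<xi>\<close> is then in the cap of radius \<open>\<delta> / 8\<close>.\<close>
  obtain X and \<epsilon> C :: real where X: "finite X" "0 < \<epsilon>" "0 \<le> C"
    and Xe: "\<And>x. x \<in> X \<Longrightarrow> (x - e) \<bullet> e = 0 \<and> norm (x - e) \<le> 1 / 32"
    and norming: "\<And>(p :: real^'n \<Rightarrow> 'k) \<beta> M. hom_poly L p \<Longrightarrow>
      (\<And>x. x \<in> X \<Longrightarrow> norm (\<beta> x - x) < \<epsilon> \<and> norm (p (\<beta> x)) \<le> M) \<Longrightarrow>
      norm (p e) \<le> C * M \<and> (M = 0 \<longrightarrow> (\<forall>z. p z = 0))"
    by (rule hom_poly_norming[OF e, of "1/32" L]) (simp, blast)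
  \<comment> \<open>The first bound keeps the selected node in that cap; the second outweighs the
    Lipschitz constant 8 of central projection.\<close>
  define \<eta> where "\<eta> = min (1 / 16) (\<epsilon> / 16)"
  have \<eta>: "0 < \<eta>" "\<eta> \<le> 1 / 16" "16 * \<eta> \<le> \<epsilon>"
    using X(2) by (auto simp: \<eta>_def)
  show thesis
  \<comment> \<open>Nodes lie on the sphere, norming points in the tangent plane. Since
    \<open>z \<bullet> y\<close> is at least 1/2, projecting a node \<open>z\<close> centrally
    enlarges the value of \<open>p\<close> by at most \<open>2 ^ L\<close>.\<close>
  proof (rule that[of \<eta> "C * 2 ^ L"])
    fix p :: "real^'n \<Rightarrow> 'k" and Y \<delta> y M
    assume p: "hom_poly L p" and Y: "Y \<subseteq> sphere 0 1" and \<delta>: "0 < \<delta>" "\<delta> \<le> 1"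
      and y: "y \<in> sphere 0 1"
      and dense: "\<And>x. x \<in> sphere 0 1 \<Longrightarrow> \<exists>z\<in>Y. norm (z - x) \<le> \<eta> * \<delta>"
      and small: "\<And>z. z \<in> Y \<Longrightarrow> norm (z - y) \<le> \<delta> / 8 \<Longrightarrow> norm (p z) \<le> M"
    have ny: "norm y = 1" "y \<bullet> y = 1" and ee: "e \<bullet> e = 1"
      using y e by (auto simp: dot_square_norm)
    obtain Q where Q: "orthogonal_transformation Q" "Q e = y"
      using orthogonal_transformation_exists[of e y] e ny by auto
    have Ql: "linear Q" using Q(1) by (rule orthogonal_transformation_linear)
    have Qi: "Q a \<bullet> Q b = a \<bullet> b" for a b
      using Q(1) by (simp add: orthogonal_transformation_def)
    have Qn: "norm (Q a) = norm a" for a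
      using Q(1) by (simp add: orthogonal_transformation_norm)
    have Qs: "\<exists>u. Q u = a \<and> u \<bullet> e = a \<bullet> y" for a
      using orthogonal_transformation_surj[OF Q(1)] Qi[of _ e] Q(2) by (metis surjD)
    define T where "T w = (w \<bullet> e) *\<^sub>R y + \<delta> *\<^sub>R Q (w - (w \<bullet> e) *\<^sub>R e)" for w
    have Tl: "linear T"
      unfolding T_def[abs_def]
      by (rule linearI) (simp_all add: linear_diff[OF Ql] linear_add[OF Ql] linear_scale[OF Ql]
          inner_add_left algebra_simps)
    have T_tangent: "T (e + v) = y + \<delta> *\<^sub>R Q v" if "v \<bullet> e = 0" for v
      using that ee by (simp add: T_def inner_add_left)
    have pT: "hom_poly L (\<lambda>w. p (T w))"
      by (rule hom_poly_compose_linear[OF p Tl])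
    have "\<exists>b. norm (b - x) < \<epsilon> \<and> norm (p (T b)) \<le> 2 ^ L * M" if x: "x \<in> X" for x
    proof -
      define v where "v = x - e"
      have v: "v \<bullet> e = 0" "norm v \<le> 1 / 32" using Xe[OF x] by (auto simp: v_def)
      define t where "t = y + \<delta> *\<^sub>R Q v"
      have ty: "t \<bullet> y = 1"
        using v ny Q(2) Qi[of v e] by (simp add: t_def inner_add_left)
      have t1: "1 \<le> norm t"
        using Cauchy_Schwarz_ineq2[of t y] ty ny by simp
      have t2: "norm (t - y) \<le> \<delta> / 32"
        using v \<delta> by (simp add: t_def Qn)
      define \<xi> where "\<xi> = t /\<^sub>R norm t"
      have t0: "0 < norm t" using t1 by linarith
      then have \<xi>1: "norm \<xi> = 1" by (simp add: \<xi>_def)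
      have \<xi>y: "\<xi> \<bullet> y = 1 / norm t" using ty by (simp add: \<xi>_def divide_inverse)
      have "\<xi> - t = (1 / norm t - 1) *\<^sub>R t" by (simp add: \<xi>_def scaleR_diff_left divide_inverse)
      then have "norm (\<xi> - t) = \<bar>(1 / norm t - 1) * norm t\<bar>" by (simp add: abs_mult)
      also have "\<dots> = norm t - 1" using t1 t0 by (simp add: left_diff_distrib)
      also have "\<dots> \<le> norm (t - y)" using norm_triangle_ineq2[of t y] ny by simp
      finally have "norm (\<xi> - y) \<le> \<delta> / 16"
        using t2 norm_triangle_ineq[of "\<xi> - t" "t - y"] by simp
      moreover obtain z where z: "z \<in> Y" "norm (z - \<xi>) \<le> \<eta> * \<delta>"
        using dense[of \<xi>] \<xi>1 by auto
      moreover have "\<eta> * \<delta> \<le> 1 / 16 * \<delta>"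
        using \<eta> \<delta> by (intro mult_right_mono) auto
      moreover have "norm (z - y) \<le> norm (z - \<xi>) + norm (\<xi> - y)"
        using norm_triangle_ineq[of "z - \<xi>" "\<xi> - y"] by simp
      ultimately have zy: "norm (z - y) \<le> \<delta> / 8" and \<xi>y': "norm (\<xi> - y) \<le> 1 / 16"
        using \<delta> by linarith+
      have z1: "norm z = 1" using z Y by auto
      have half: "1 / 2 \<le> a \<bullet> y" if "norm a = 1" "norm (a - y) \<le> 1" for a
        using inner_unit_eq[OF that(1) ny(1)] power_le_one[OF norm_ge_zero that(2), of 2] by simp
      have zy2: "1 / 2 \<le> z \<bullet> y" by (rule half) (use z1 zy \<delta> in auto)
      have \<xi>y2: "1 / 2 \<le> \<xi> \<bullet> y" by (rule half) (use \<xi>1 \<xi>y' in auto)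
      obtain u where u: "Q u = z /\<^sub>R (z \<bullet> y) - y" "u \<bullet> e = (z /\<^sub>R (z \<bullet> y) - y) \<bullet> y"
        using Qs by blast
      have ue: "u \<bullet> e = 0"
        using zy2 ny by (simp add: u(2) inner_diff_left)
      \<comment> \<open>The preimage under \<open>T\<close> of the central projection of
        \<open>z\<close>, that is, the node as seen in the fixed configuration.\<close>
      define b where "b = e + u /\<^sub>R \<delta>"
      have "T b = y + \<delta> *\<^sub>R Q (u /\<^sub>R \<delta>)"
        unfolding b_def by (rule T_tangent) (simp add: ue)
      also have "\<dots> = z /\<^sub>R (z \<bullet> y)"
        using \<delta> by (simp add: linear_scale[OF Ql] u(1))
      finally have Tb: "T b = z /\<^sub>R (z \<bullet> y)" .
      have "norm (p (T b)) = inverse (z \<bullet> y) ^ L * norm (p z)"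
        unfolding Tb hom_poly_scaleR[OF p] using zy2 by (simp add: norm_mult norm_power norm_inverse)
      also have "\<dots> \<le> 2 ^ L * M"
        using small[OF z(1) zy] zy2 
        by (intro mult_mono power_mono) (auto simp: divide_simps)
      finally have 1: "norm (p (T b)) \<le> 2 ^ L * M" .
      have "b - x = (1 / \<delta>) *\<^sub>R (u - \<delta> *\<^sub>R v)"
        using \<delta> by (simp add: b_def v_def algebra_simps divide_inverse)
      then have "norm (b - x) = norm (Q (u - \<delta> *\<^sub>R v)) / \<delta>"
        using \<delta> by (simp add: Qn)
      also have "Q (u - \<delta> *\<^sub>R v) = z /\<^sub>R (z \<bullet> y) - t"
        by (simp add: linear_diff[OF Ql] linear_scale[OF Ql] u(1) t_def)
      also have "t = \<xi> /\<^sub>R (\<xi> \<bullet> y)"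
        using t0 by (simp add: \<xi>y) (simp add: \<xi>_def)
      also have "norm (z /\<^sub>R (z \<bullet> y) - \<xi> /\<^sub>R (\<xi> \<bullet> y)) / \<delta> \<le> 8 * norm (z - \<xi>) / \<delta>"
        using \<delta> by (intro divide_right_mono central_projection_lipschitz \<xi>1 z1 ny zy2 \<xi>y2) auto
      also have "\<dots> \<le> 8 * \<eta>"
        using z(2) \<delta> by (simp add: divide_simps)
      also have "\<dots> < \<epsilon>" using \<eta> by simp
      finally show ?thesis using 1 by blast
    qed
    then obtain \<beta> where "\<And>x. x \<in> X \<Longrightarrow> norm (\<beta> x - x) < \<epsilon> \<and> norm (p (T (\<beta> x))) \<le> 2 ^ L * M"
      by metis
    from norming[OF pT, of \<beta> "2 ^ L * M", OF this]
    have N: "norm (p (T e)) \<le> C * (2 ^ L * M)" "M = 0 \<Longrightarrow> p (T w) = 0" for w by auto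
    have Te: "T e = y" using T_tangent[of 0] linear_0[OF Ql] by simp
    \<comment> \<open>Surjectivity carries the vanishing of \<open>p\<close> after \<open>T\<close>
      over to \<open>p\<close> itself.\<close>
    have "\<exists>w. T w = x" for x
    proof -
      obtain u where u: "Q u = x - (x \<bullet> y) *\<^sub>R y" "u \<bullet> e = (x - (x \<bullet> y) *\<^sub>R y) \<bullet> y"
        using Qs by blast
      have "u \<bullet> e = 0" using ny by (simp add: u(2) inner_diff_left)
      then have "T ((x \<bullet> y) *\<^sub>R e + u /\<^sub>R \<delta>) = x"
        using ee \<delta> by (simp add: T_def inner_add_left linear_scale[OF Ql] u(1))
      then show ?thesis by blast
    qed
    then show "norm (p y) \<le> C * 2 ^ L * M \<and> (M = 0 \<longrightarrow> (\<forall>z. p z = 0))"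
      using N Te by (metis mult.assoc)
  qed (use \<eta> X in auto)
qed

subsection \<open>Node sets on the sphere\<close>

text \<open>The cubic Taylor bound leaves \<open>u - u^3 / 6\<close>, and \<open>u^2\<close> is at
  most 4. The range up to 2 covers the half angles up to \<open>pi / 2\<close>.\<close>

lemma sin_ge_third:
  assumes "0 \<le> u" "u \<le> 2"
  shows "u / 3 \<le> sin (u::real)"
proof -
  have "\<bar>sin u - u\<bar> \<le> \<bar>u\<bar> ^ 3 / 6"
    using Maclaurin_sin_bound[of u 3] by (simp add: sin_coeff_def numeral_3_eq_3 fact_numeral)
  then have "u - u ^ 3 / 6 \<le> sin u" using assms by (simp add: abs_if split: if_splits)
  moreover have "u * (u * u) \<le> u * (2 * 2)"
    using assms by (intro mult_mono) auto
  ultimately show ?thesis by (simp add: power3_eq_cube)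
qed

text \<open>The chord over an arc of length \<open>t\<close> is
  \<open>2 * sin (t / 2)\<close>.\<close>

lemma gc_dist_bounds:
  assumes "norm x = 1" "norm y = 1"
  shows "norm (x - y) \<le> gc_dist x y" "gc_dist x y \<le> 3 * norm (x - y)" "gc_dist x y \<le> pi"
proof -
  define t where "t = gc_dist x y"
  have xy: "-1 \<le> x \<bullet> y" "x \<bullet> y \<le> 1"
    using Cauchy_Schwarz_ineq2[of x y] assms by auto
  have t: "0 \<le> t" "t \<le> pi" "cos t = x \<bullet> y"
    using arccos_bounded[OF xy] xy by (auto simp: t_def gc_dist_def cos_arccos)
  have s: "0 \<le> sin (t / 2)" using t by (intro sin_ge_zero) auto
  have "(norm (x - y))\<^sup>2 = 2 - 2 * cos (2 * (t / 2))"
    using assms t(3) by (simp add: power2_norm_eq_inner inner_diff_left inner_diff_right inner_commute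
      norm_eq_1)
  also have "\<dots> = (2 * sin (t / 2))\<^sup>2"
    unfolding cos_double_sin by (simp add: power_mult_distrib)
  finally have n: "norm (x - y) = 2 * sin (t / 2)"
    by (rule power2_eq_imp_eq) (use s in auto)
  show "norm (x - y) \<le> gc_dist x y"
    unfolding n t_def[symmetric] using sin_x_le_x[of "t / 2"] t by simp
  have "t / 2 / 3 \<le> sin (t / 2)"
    using t pi_less_4 by (intro sin_ge_third) auto
  then show "gc_dist x y \<le> 3 * norm (x - y)" 
    unfolding n t_def[symmetric] by simp
  show "gc_dist x y \<le> pi" using t by (simp add: t_def)
qed

lemma gc_dist_commute: "gc_dist x y = gc_dist y x"
  by (simp add: gc_dist_def inner_commute)

lemma gc_dist_pos:
  assumes "norm x = 1" "norm y = 1" "x \<noteq> y"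
  shows "0 < gc_dist x y"
proof -
  have "0 < norm (x - y)" using assms(3) by simp
  also have "\<dots> \<le> gc_dist x y" by (rule gc_dist_bounds(1)[OF assms(1,2)])
  finally show ?thesis .
qed

lemma node_set_norm: "node_set Y \<Longrightarrow> z \<in> Y \<Longrightarrow> norm z = 1"
  by (auto simp: node_set_def)

lemma fill_dist_bdd:
  assumes "node_set Y"
  shows "bdd_above ((\<lambda>y. Min ((\<lambda>z. gc_dist z y) ` Y)) ` sphere 0 1)"
proof -
  from assms obtain z where z: "z \<in> Y" "finite Y"
    by (auto simp: node_set_def numeral_2_eq_2 card_le_Suc_iff)
  have "Min ((\<lambda>z. gc_dist z y) ` Y) \<le> pi" if "y \<in> sphere 0 1" for y
  proof -
    have "Min ((\<lambda>z. gc_dist z y) ` Y) \<le> gc_dist z y" using z by (intro Min_le) auto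
    also have "\<dots> \<le> pi" using z that node_set_norm[OF assms] by (intro gc_dist_bounds) auto
    finally show ?thesis .
  qed
  then show ?thesis by (rule bdd_aboveI2)
qed

lemma fill_dist_nearest:
  assumes "node_set Y" "y \<in> sphere 0 1"
  shows "\<exists>z\<in>Y. gc_dist z y \<le> fill_dist Y"
proof -
  have "Min ((\<lambda>z. gc_dist z y) ` Y) \<in> (\<lambda>z. gc_dist z y) ` Y"
    using assms by (intro Min_in) (auto simp: node_set_def)
  then obtain z where z: "z \<in> Y" "Min ((\<lambda>z. gc_dist z y) ` Y) = gc_dist z y" by blast
  have "Min ((\<lambda>z. gc_dist z y) ` Y) \<le> fill_dist Y"
    unfolding fill_dist_def by (rule cSUP_upper[OF assms(2) fill_dist_bdd[OF assms(1)]])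
  with z show ?thesis by metis
qed

text \<open>From dimension 2 on the sphere is connected, so it is not a finite set of at least two
  points and some point of it is no node. In dimension 1 the two points of the sphere would form a
  node set of fill distance 0.\<close>

lemma fill_dist_pos:
  fixes Y :: "(real^'n) set"
  assumes "node_set Y" "2 \<le> CARD('n)"
  shows "0 < fill_dist Y"
proof -
  have "\<not> sphere 0 1 \<subseteq> Y"
  proof
    assume "sphere 0 1 \<subseteq> Y"
    then have Y: "Y = sphere 0 1" "finite Y" "2 \<le> card Y" using assms(1) by (auto simp: node_set_def)
    have "connected Y" unfolding Y(1) using assms(2) by (intro connected_sphere) simp
    with Y(2) have "Y = {} \<or> (\<exists>x. Y = {x})" by (simp add: connected_finite_iff_sing)
    with Y(3) show False by auto
  qed
  then obtain y where y: "y \<in> sphere 0 1" "y \<notin> Y" by blast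
  from fill_dist_nearest[OF assms(1) y(1)] obtain z where "z \<in> Y" "gc_dist z y \<le> fill_dist Y" by blast
  moreover have "0 < gc_dist z y"
    using y \<open>z \<in> Y\<close> node_set_norm[OF assms(1)] by (intro gc_dist_pos) auto
  ultimately show ?thesis by simp
qed

lemma sep_dist_properties:
  assumes "node_set Y"
  shows "0 < sep_dist Y" "\<And>y z. y \<in> Y \<Longrightarrow> z \<in> Y \<Longrightarrow> y \<noteq> z \<Longrightarrow> 2 * sep_dist Y \<le> gc_dist y z"
proof -
  let ?D = "{gc_dist y z | y z. y \<in> Y \<and> z \<in> Y \<and> y \<noteq> z}"
  have "?D \<subseteq> (\<lambda>(y, z). gc_dist y z) ` (Y \<times> Y)" by auto
  moreover have "finite Y" using assms by (simp add: node_set_def)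
  ultimately have fin: "finite ?D" by (meson finite_SigmaI finite_imageI finite_subset)
  from assms obtain a b where "a \<in> Y" "b \<in> Y" "a \<noteq> b"
    by (auto simp: node_set_def numeral_2_eq_2 card_le_Suc_iff)
  then have "?D \<noteq> {}" by blast
  with fin have "Min ?D \<in> ?D" by (rule Min_in)
  then obtain y z where "y \<in> Y" "z \<in> Y" "y \<noteq> z" "Min ?D = gc_dist y z" by blast
  then show "0 < sep_dist Y"
    using node_set_norm[OF assms] by (simp add: sep_dist_def gc_dist_pos)
  show "2 * sep_dist Y \<le> gc_dist y z" if "y \<in> Y" "z \<in> Y" "y \<noteq> z" for y z
    unfolding sep_dist_def using fin that by (auto intro!: Min_le)
qed

text \<open>Rescaling by \<open>h\<close> moves \<open>Z\<close> into a fixed ball covered by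
  finitely many balls of radius \<open>a / 2\<close>, each of which holds at most one rescaled
  point. The size of the cover is therefore a bound for all centres and scales.\<close>

lemma separated_card_bound:
  fixes a b :: real
  assumes "0 < a"
  obtains K :: nat where "\<And>Z (y :: 'a::euclidean_space) h. 0 < h \<Longrightarrow> Z \<subseteq> cball y (b * h) \<Longrightarrow>
    (\<And>z z'. z \<in> Z \<Longrightarrow> z' \<in> Z \<Longrightarrow> z \<noteq> z' \<Longrightarrow> a * h \<le> dist z z') \<Longrightarrow> card Z \<le> K"
proof -
  have "cball (0::'a) b \<subseteq> (\<Union>x\<in>cball 0 b. ball x (a / 2))" using assms by force
  then obtain T where T: "finite T" "cball (0::'a) b \<subseteq> (\<Union>x\<in>T. ball x (a / 2))"
    using compactE_image[OF compact_cball[of "0::'a" b], of "cball 0 b" "\<lambda>x. ball x (a / 2)"]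
    by (metis open_ball)
  show thesis
  proof (rule that[of "card T"])
    fix Z and y :: 'a and h :: real
    assume h: "0 < h" and Z: "Z \<subseteq> cball y (b * h)"
      and sep: "\<And>z z'. z \<in> Z \<Longrightarrow> z' \<in> Z \<Longrightarrow> z \<noteq> z' \<Longrightarrow> a * h \<le> dist z z'"
    have "\<exists>x\<in>T. dist x ((z - y) /\<^sub>R h) < a / 2" if "z \<in> Z" for z
    proof -
      have "norm (z - y) \<le> b * h" using Z that by (auto simp: dist_norm norm_minus_commute)
      then have "(z - y) /\<^sub>R h \<in> cball 0 b" using h by (simp add: divide_simps)
      with T(2) show ?thesis by fastforce
    qed
    then obtain \<tau> where \<tau>: "\<And>z. z \<in> Z \<Longrightarrow> \<tau> z \<in> T"
      "\<And>z. z \<in> Z \<Longrightarrow> dist (\<tau> z) ((z - y) /\<^sub>R h) < a / 2" by metis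
    have "inj_on \<tau> Z"
    proof (rule inj_onI, rule ccontr)
      fix z z' assume z: "z \<in> Z" "z' \<in> Z" "\<tau> z = \<tau> z'" "z \<noteq> z'"
      have "dist ((z - y) /\<^sub>R h) ((z' - y) /\<^sub>R h) < a"
        using dist_triangle_half_r[OF \<tau>(2)[OF z(1)]] \<tau>(2)[OF z(2)] z(3) by simp
      also have "dist ((z - y) /\<^sub>R h) ((z' - y) /\<^sub>R h) = dist z z' / h"
      proof -
        have "(z - y) /\<^sub>R h - (z' - y) /\<^sub>R h = (z - z') /\<^sub>R h" by (simp add: algebra_simps)
        then show ?thesis using h by (simp add: dist_norm divide_inverse)
      qed
      finally show False using sep[OF z(1,2,4)] h by (simp add: divide_simps)
    qed
    then show "card Z \<le> card T"
      using \<tau>(1) T(1) by (intro card_inj_on_le) auto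
  qed
qed

subsection \<open>Weighted least squares\<close>

text \<open>Gram-Schmidt for the normal equations in the semi-inner product of the weights. Weights
  may vanish and the \<open>b i\<close> may be dependent, so only existence is claimed. The data
  \<open>f\<close> stay general because the induction hypothesis is used for \<open>f\<close> and
  for \<open>b j\<close>.\<close>

lemma weighted_least_squares:
  fixes b :: "'i \<Rightarrow> 'a \<Rightarrow> 'v::real_inner"
  assumes "finite I" "finite Z" and W: "\<And>z. z \<in> Z \<Longrightarrow> 0 \<le> W z"
  shows "\<exists>c. \<forall>j\<in>I. (\<Sum>z\<in>Z. W z * ((f z - (\<Sum>i\<in>I. c i *\<^sub>R b i z)) \<bullet> b j z)) = 0"
  using assms(1)
proof (induction I arbitrary: f)
  case empty
  show ?case by simp
next
  case (insert j I)
  define ip where "ip u v = (\<Sum>z\<in>Z. W z * (u z \<bullet> v z))" for u v :: "'a \<Rightarrow> 'v"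
  have ip_diff: "ip (\<lambda>z. u z - t *\<^sub>R v z) q = ip u q - t * ip v q" for u v q t
    by (simp add: ip_def inner_diff_left algebra_simps sum_subtractf sum_distrib_left)
  from insert.IH[of f] obtain c where c: "\<And>i. i \<in> I \<Longrightarrow> ip (\<lambda>z. f z - (\<Sum>i\<in>I. c i *\<^sub>R b i z)) (b i) = 0"
    unfolding ip_def by blast
  from insert.IH[of "b j"] obtain e where
    e: "\<And>i. i \<in> I \<Longrightarrow> ip (\<lambda>z. b j z - (\<Sum>i\<in>I. e i *\<^sub>R b i z)) (b i) = 0"
    unfolding ip_def by blast
  define u where "u z = f z - (\<Sum>i\<in>I. c i *\<^sub>R b i z)" for z
  define g where "g z = b j z - (\<Sum>i\<in>I. e i *\<^sub>R b i z)" for z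
  have ug: "ip v g = ip v (b j)" if "\<And>i. i \<in> I \<Longrightarrow> ip v (b i) = 0" for v
  proof -
    have "ip v (\<lambda>z. \<Sum>i\<in>I. e i *\<^sub>R b i z) = (\<Sum>i\<in>I. e i * ip v (b i))"
      unfolding ip_def inner_sum_right sum_distrib_left
      by (subst sum.swap) (simp add: mult_ac)
    also have "\<dots> = 0" using that by simp
    finally have "(\<Sum>z\<in>Z. W z * (v z \<bullet> (\<Sum>i\<in>I. e i *\<^sub>R b i z))) = 0" by (simp add: ip_def)
    then show ?thesis
      by (simp add: ip_def g_def inner_diff_right right_diff_distrib sum_subtractf)
  qed
  have ui: "ip u (b i) = 0" and gi: "ip g (b i) = 0" if "i \<in> I" for i
    using c[OF that] e[OF that] by (simp_all add: u_def[abs_def] g_def[abs_def])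
  have null: "ip u g = 0" if "ip g g = 0"
  proof -
    have "\<forall>z\<in>Z. W z * (g z \<bullet> g z) = 0"
      using that assms(2) W unfolding ip_def by (subst (asm) sum_nonneg_eq_0_iff) auto
    then show ?thesis unfolding ip_def by (intro sum.neutral) auto
  qed
  \<comment> \<open>If \<open>ip g g = 0\<close>, division by zero gives \<open>t = 0\<close>, which
    is right because then \<open>ip u (b j) = ip u g = 0\<close> by \<open>ug\<close> and
    \<open>null\<close>.\<close>
  define t where "t = ip u g / ip g g"
  have "ip u (b j) - t * ip g (b j) = 0"
    using ug[of u] ug[of g] ui gi null by (cases "ip g g = 0") (auto simp: t_def)
  then have *: "ip (\<lambda>z. u z - t *\<^sub>R g z) (b i) = 0" if "i \<in> insert j I" for i
    using that ui gi by (auto simp: ip_diff)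
  define c' where "c' i = (if i = j then t else c i - t * e i)" for i
  have "(\<Sum>i\<in>insert j I. c' i *\<^sub>R b i z) = t *\<^sub>R b j z + (\<Sum>i\<in>I. (c i - t * e i) *\<^sub>R b i z)" for z
  proof -
    have "(\<Sum>i\<in>I. c' i *\<^sub>R b i z) = (\<Sum>i\<in>I. (c i - t * e i) *\<^sub>R b i z)"
      using insert.hyps by (intro sum.cong) (auto simp: c'_def)
    then show ?thesis using insert.hyps by (simp add: c'_def)
  qed
  then have "f z - (\<Sum>i\<in>insert j I. c' i *\<^sub>R b i z) = u z - t *\<^sub>R g z" for z
    by (simp add: u_def g_def algebra_simps sum_subtractf scaleR_sum_right)
  with * show ?case
    unfolding ip_def by (intro exI[of _ c']) simp
qed

lemma hom_poly_least_squares: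
  fixes f :: "real^'n \<Rightarrow> 'k::{real_normed_field, euclidean_space}"
  assumes "finite Z" "\<And>z. z \<in> Z \<Longrightarrow> 0 \<le> W z"
  shows "\<exists>p. hom_poly L p \<and> (\<forall>q. hom_poly L q \<longrightarrow> (\<Sum>z\<in>Z. W z * ((f z - p z) \<bullet> q z)) = 0)"
proof -
  define m where "m \<alpha> x = (of_real (\<Prod>i\<in>UNIV. (x $ i) ^ \<alpha> i) :: 'k)" for \<alpha> and x :: "real^'n"
  have m: "hom_poly L (m \<alpha>)" if "\<alpha> \<in> multi_indices L" for \<alpha>
  proof -
    have "m \<alpha> x = (\<Sum>\<beta>\<in>multi_indices L. (if \<beta> = \<alpha> then 1 else 0) * m \<beta> x)" for x
    proof -
      have "(\<Sum>\<beta>\<in>multi_indices L. (if \<beta> = \<alpha> then 1 else 0) * m \<beta> x) =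
          (\<Sum>\<beta>\<in>multi_indices L. if \<beta> = \<alpha> then m \<beta> x else 0)"
        by (rule sum.cong) auto
      then show ?thesis using that by (simp add: finite_multi_indices)
    qed
    then have "m \<alpha> \<in> Hom_space L"
      unfolding Hom_space_def m_def mem_Collect_eq
      by (intro exI[of _ "\<lambda>\<beta>. if \<beta> = \<alpha> then 1 else 0"] conjI TrueI ext)
    then show ?thesis by (simp add: Hom_space_iff_hom_poly)
  qed
  \<comment> \<open>The inner product is the real one also for complex scalars. Monomials times the
    real basis of the scalar field, combined with real coefficients, reach every combination over
    that field.\<close>
  define b where "b = (\<lambda>(\<alpha>, k) x. k * m \<alpha> x)"
  let ?I = "multi_indices L \<times> (Basis :: 'k set)"
  have fin: "finite ?I" by (simp add: finite_multi_indices)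
  from weighted_least_squares[OF fin assms(1), where W = W and f = f and b = b, OF assms(2)]
  obtain c where
    c: "\<And>j. j \<in> ?I \<Longrightarrow> (\<Sum>z\<in>Z. W z * ((f z - (\<Sum>i\<in>?I. c i *\<^sub>R b i z)) \<bullet> b j z)) = 0" by blast
  define p where "p z = (\<Sum>i\<in>?I. c i *\<^sub>R b i z)" for z
  have "hom_poly L (\<lambda>z. \<Sum>i\<in>?I. of_real (c i) * b i z)"
    by (intro hom_poly_sum hom_poly_cmult) (auto simp: b_def intro!: hom_poly_cmult m)
  then have p: "hom_poly L p" by (simp add: p_def[abs_def] scaleR_conv_of_real)
  have "(\<Sum>z\<in>Z. W z * ((f z - p z) \<bullet> q z)) = 0" if "hom_poly L q" for q
  proof -
    from that obtain a where a: "\<And>z. q z = (\<Sum>\<alpha>\<in>multi_indices L. a \<alpha> * m \<alpha> z)"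
      unfolding Hom_space_iff_hom_poly[symmetric] Hom_space_def m_def by blast
    have "q z = (\<Sum>(\<alpha>, k)\<in>?I. (a \<alpha> \<bullet> k) *\<^sub>R b (\<alpha>, k) z)" for z
    proof -
      have "a \<alpha> * m \<alpha> z = (\<Sum>k\<in>Basis. (a \<alpha> \<bullet> k) *\<^sub>R b (\<alpha>, k) z)" for \<alpha>
      proof -
        have "a \<alpha> * m \<alpha> z = (\<Sum>k\<in>Basis. (a \<alpha> \<bullet> k) *\<^sub>R k) * m \<alpha> z" by (simp only: euclidean_representation)
        then show ?thesis by (simp add: sum_distrib_right b_def)
      qed
      then show ?thesis by (simp add: a sum.cartesian_product)
    qed
    then have "(\<Sum>z\<in>Z. W z * ((f z - p z) \<bullet> q z)) =
       (\<Sum>z\<in>Z. \<Sum>i\<in>?I. (a (fst i) \<bullet> snd i) * (W z * ((f z - p z) \<bullet> b i z)))"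
      by (simp add: inner_sum_right sum_distrib_left case_prod_beta mult_ac)
    also have "\<dots> = (\<Sum>i\<in>?I. (a (fst i) \<bullet> snd i) * (\<Sum>z\<in>Z. W z * ((f z - p z) \<bullet> b i z)))"
      by (subst sum.swap) (simp add: sum_distrib_left)
    also have "\<dots> = 0"
      using c by (intro sum.neutral) (auto simp: p_def)
    finally show ?thesis .
  qed
  with p show ?thesis by blast
qed

text \<open>Orthogonality of the residual gives Pythagoras: the functional at \<open>q\<close>
  exceeds that at \<open>p\<close> by the weighted square sum of \<open>p - q\<close>. Hence
  \<open>p\<close> is minimal, and for another minimiser \<open>p - q\<close> vanishes at all nodes
  of positive weight.\<close>

lemma mls_solution_H2_space:
  fixes f :: "real^'n \<Rightarrow> 'k::{real_normed_field, euclidean_space}"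
  assumes Y: "finite Y" "Y \<subseteq> sphere 0 1" and w: "\<And>z. z \<in> Y \<Longrightarrow> 0 \<le> w y z"
    and unisolvent: "\<And>p :: real^'n \<Rightarrow> 'k. hom_poly L p \<Longrightarrow>
      (\<And>z. z \<in> Y \<Longrightarrow> 0 < w y z \<Longrightarrow> p z = 0) \<Longrightarrow> \<forall>z. p z = 0"
  shows "\<exists>!g. mls_solution (H2_space L) Y w f y g"
    "\<exists>p. hom_poly L p \<and> (THE g. mls_solution (H2_space L) Y w f y g) = restrict p (sphere 0 1) \<and>
      (\<forall>q. hom_poly L q \<longrightarrow>
        (\<Sum>z\<in>Y. w y z * (norm (f z - p z))\<^sup>2) \<le> (\<Sum>z\<in>Y. w y z * (norm (f z - q z))\<^sup>2))"
proof -
  obtain p where p: "hom_poly L p"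
    and orth: "\<And>q. hom_poly L q \<Longrightarrow> (\<Sum>z\<in>Y. w y z * ((f z - p z) \<bullet> q z)) = 0"
    using hom_poly_least_squares[of Y "w y" L f, OF Y(1) w] by blast
  define J where "J q = (\<Sum>z\<in>Y. w y z * (norm (f z - q z))\<^sup>2)" for q
  have J: "mls_functional Y w f y (restrict q (sphere 0 1)) = J q" for q
    unfolding mls_functional_def J_def using Y(2) by (intro sum.cong) auto
  have pythagoras: "J q = J p + (\<Sum>z\<in>Y. w y z * (norm (p z - q z))\<^sup>2)" if q: "hom_poly L q" for q
  proof -
    have "w y z * (norm (f z - q z))\<^sup>2 = w y z * (norm (f z - p z))\<^sup>2 +
        w y z * (norm (p z - q z))\<^sup>2 + 2 * (w y z * ((f z - p z) \<bullet> (p z - q z)))" for z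
      by (simp add: power2_norm_eq_inner inner_diff_left inner_diff_right inner_commute algebra_simps)
    then have "J q = J p + (\<Sum>z\<in>Y. w y z * (norm (p z - q z))\<^sup>2) +
        2 * (\<Sum>z\<in>Y. w y z * ((f z - p z) \<bullet> (p z - q z)))"
      by (simp add: J_def sum.distrib sum_distrib_left)
    then show ?thesis using orth[OF hom_poly_diff[OF p q]] by simp
  qed
  have nonneg: "0 \<le> (\<Sum>z\<in>Y. w y z * (norm (p z - q z))\<^sup>2)" for q
    using w by (intro sum_nonneg) auto
  have min: "J p \<le> J q" if "hom_poly L q" for q
    using pythagoras[OF that] nonneg[of q] by simp
  have sol: "mls_solution (H2_space L) Y w f y (restrict p (sphere 0 1))"
    unfolding mls_solution_def H2_space_eq using p min by (auto simp: J)
  have uniq: "g = restrict p (sphere 0 1)" if g: "mls_solution (H2_space L) Y w f y g" for g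
  proof -
    from g obtain q where q: "hom_poly L q" "g = restrict q (sphere 0 1)"
      unfolding mls_solution_def H2_space_eq by blast
    have "restrict p (sphere 0 1) \<in> H2_space L" unfolding H2_space_eq using p by blast
    with g have "mls_functional Y w f y g \<le> mls_functional Y w f y (restrict p (sphere 0 1))"
      unfolding mls_solution_def by blast
    then have "J q \<le> J p" by (simp add: J q(2))
    then have "(\<Sum>z\<in>Y. w y z * (norm (p z - q z))\<^sup>2) = 0"
      using pythagoras[OF q(1)] nonneg[of q] by simp
    then have *: "\<forall>z\<in>Y. w y z * (norm (p z - q z))\<^sup>2 = 0"
      using w Y(1) by (subst (asm) sum_nonneg_eq_0_iff) auto
    have "\<forall>z. p z - q z = 0"
      by (rule unisolvent[OF hom_poly_diff[OF p q(1)]]) (use * in force)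
    then have "p = q" by (intro ext) simp
    then show ?thesis using q(2) by simp
  qed
  show ex1: "\<exists>!g. mls_solution (H2_space L) Y w f y g"
    using sol uniq by blast
  have "(THE g. mls_solution (H2_space L) Y w f y g) = restrict p (sphere 0 1)"
    using sol uniq by (rule the_equality)
  then show "\<exists>p. hom_poly L p \<and> (THE g. mls_solution (H2_space L) Y w f y g) = restrict p (sphere 0 1) \<and>
      (\<forall>q. hom_poly L q \<longrightarrow>
        (\<Sum>z\<in>Y. w y z * (norm (f z - p z))\<^sup>2) \<le> (\<Sum>z\<in>Y. w y z * (norm (f z - q z))\<^sup>2))"
    using p min unfolding J_def by blast
qed

subsection \<open>Taylor approximation on the sphere\<close>

lemma partial_deriv_cong_open:
  assumes "open U" "x \<in> U" "F differentiable (at x)" "\<And>y. y \<in> U \<Longrightarrow> F y = G y"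
  shows "G differentiable (at x)" "partial_deriv i G x = partial_deriv i F x"
proof -
  from assms(3) obtain F' where F': "(F has_derivative F') (at x)"
    unfolding differentiable_def by blast
  have "(G has_derivative F') (at x)"
    by (rule has_derivative_transform_within_open[OF F' assms(1,2)]) (rule assms(4))
  with F' show "G differentiable (at x)" "partial_deriv i G x = partial_deriv i F x"
    by (auto simp: partial_deriv_eq differentiable_def)
qed

text \<open>\<open>Ck_on\<close> recurses through \<open>partial_deriv\<close> as a function on the
  whole space, whereas differentiation rules identify it only at points of \<open>U\<close>.
  Openness makes the values on \<open>U\<close> sufficient.\<close>

lemma Ck_on_cong:
  assumes "open U" "Ck_on k U F" "\<And>x. x \<in> U \<Longrightarrow> F x = G x"
  shows "Ck_on k U G"
  using assms(2,3)
proof (induction k arbitrary: F G)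
  case 0
  then show ?case using continuous_on_cong[of U U F G] by simp
next
  case (Suc k)
  have dF: "F differentiable (at x)" if "x \<in> U" for x
    using Suc.prems(1) that by simp
  have "Ck_on k U (partial_deriv i G)" for i
  proof (rule Suc.IH)
    show "Ck_on k U (partial_deriv i F)" using Suc.prems(1) by simp
    show "partial_deriv i F x = partial_deriv i G x" if "x \<in> U" for x
      using partial_deriv_cong_open(2)[OF assms(1) that dF[OF that] Suc.prems(2)] by simp
  qed
  moreover have "G differentiable (at x)" if "x \<in> U" for x
    using partial_deriv_cong_open(1)[OF assms(1) that dF[OF that] Suc.prems(2)] .
  ultimately show ?case by simp
qed

lemma Ck_on_subset: "Ck_on k U F \<Longrightarrow> V \<subseteq> U \<Longrightarrow> Ck_on k V F"
  by (induction k arbitrary: F) (auto intro: continuous_on_subset)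

lemma Ck_on_SucD: "Ck_on (Suc k) U F \<Longrightarrow> Ck_on k U F"
proof (induction k arbitrary: F)
  case 0
  then show ?case
    by (auto intro!: continuous_at_imp_continuous_on differentiable_imp_continuous_within)
qed auto

lemma Ck_on_const: "Ck_on k U (\<lambda>_. c)"
  by (induction k arbitrary: c) (auto simp: partial_deriv_const)

lemma Ck_on_add:
  assumes "open U" "Ck_on k U F" "Ck_on k U G"
  shows "Ck_on k U (\<lambda>x. F x + G x)"
  using assms(2,3)
proof (induction k arbitrary: F G)
  case 0
  then show ?case by (auto intro: continuous_on_add)
next
  case (Suc k)
  have "Ck_on k U (partial_deriv i (\<lambda>x. F x + G x))" for i
    by (rule Ck_on_cong[OF assms(1) Suc.IH[of "partial_deriv i F" "partial_deriv i G"]])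
      (use Suc.prems in \<open>auto simp: partial_deriv_add\<close>)
  then show ?case using Suc.prems by auto
qed

lemma Ck_on_sum:
  assumes "open U" "\<And>a. a \<in> A \<Longrightarrow> Ck_on k U (F a)"
  shows "Ck_on k U (\<lambda>x. \<Sum>a\<in>A. F a x)"
  using assms(2)
  by (induction A rule: infinite_finite_induct) (auto intro: Ck_on_const Ck_on_add[OF assms(1)])

lemma Ck_on_mult:
  fixes F G :: "real^'n \<Rightarrow> 'k::real_normed_algebra"
  assumes "open U" "Ck_on k U F" "Ck_on k U G"
  shows "Ck_on k U (\<lambda>x. F x * G x)"
  using assms(2,3)
proof (induction k arbitrary: F G)
  case 0
  then show ?case by (auto intro: continuous_on_mult)
next
  case (Suc k)
  have "Ck_on k U F" "Ck_on k U G" "\<And>i. Ck_on k U (partial_deriv i F)" "\<And>i. Ck_on k U (partial_deriv i G)"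
    using Ck_on_SucD[OF Suc.prems(1)] Ck_on_SucD[OF Suc.prems(2)] Suc.prems by auto
  then have "Ck_on k U (\<lambda>x. F x * partial_deriv i G x + partial_deriv i F x * G x)" for i
    by (intro Ck_on_add assms(1) Suc.IH)
  then have "Ck_on k U (partial_deriv i (\<lambda>x. F x * G x))" for i
    by (rule Ck_on_cong[OF assms(1)]) (use Suc.prems in \<open>auto simp: partial_deriv_mult\<close>)
  then show ?case using Suc.prems by auto
qed

lemma Ck_on_power:
  fixes F :: "real^'n \<Rightarrow> 'k::real_normed_field"
  assumes "open U" "Ck_on k U F"
  shows "Ck_on k U (\<lambda>x. F x ^ m)"
  by (induction m) (auto intro: Ck_on_const Ck_on_mult assms)

lemma Ck_on_coord: "Ck_on k U (\<lambda>x. of_real (x $ i) :: 'k::real_normed_field)"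
proof (cases k)
  case 0
  then show ?thesis by (auto intro!: continuous_intros)
qed (auto simp: partial_deriv_coord differentiable_coord Ck_on_const)

section \<open>Radial extension off the sphere\<close>

lemma has_derivative_inverse_norm:
  fixes x :: "'a::real_inner"
  assumes "x \<noteq> 0"
  shows "((\<lambda>x. inverse (norm x)) has_derivative (\<lambda>h. - (inverse (norm x) ^ 3 * (x \<bullet> h)))) (at x)"
proof -
  have "((\<lambda>x. inverse (norm x)) has_derivative
      (\<lambda>h. - (inverse (norm x) * (h \<bullet> sgn x) * inverse (norm x)))) (at x)"
    using assms by (intro Deriv.has_derivative_inverse has_derivative_norm has_derivative_ident) auto
  then show ?thesis
    by (simp add: sgn_div_norm power3_eq_cube inner_commute mult_ac)
qed

text \<open>Each partial derivative is, up to sign, a coordinate times the cube of the function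
  itself, so the induction closes.\<close>

lemma Ck_on_inverse_norm:
  "Ck_on k (- {0}) (\<lambda>x::real^'n. of_real (inverse (norm x)) :: 'k::real_normed_field)"
proof (induction k)
  case 0
  show ?case unfolding Ck_on.simps by (intro continuous_intros) auto
next
  case (Suc k)
  let ?N = "\<lambda>x::real^'n. of_real (inverse (norm x)) :: 'k"
  have D: "(?N has_derivative (\<lambda>h. of_real (- (inverse (norm x) ^ 3 * (x \<bullet> h))))) (at x)"
    if "x \<noteq> 0" for x
    by (rule has_derivative_of_real[OF has_derivative_inverse_norm[OF that]])
  have "Ck_on k (- {0}) (\<lambda>x. (- 1) * (?N x ^ 3 * of_real (x $ i)))" for i
    by (intro Ck_on_mult Ck_on_const Ck_on_power Suc Ck_on_coord) auto
  then have "Ck_on k (- {0}) (partial_deriv i ?N)" for i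
  proof (rule Ck_on_cong[rotated])
    fix x :: "real^'n" assume "x \<in> - {0}"
    then have "partial_deriv i ?N x = of_real (- (inverse (norm x) ^ 3 * (x \<bullet> axis i 1)))"
      by (intro partial_deriv_eq D) simp
    then show "(- 1) * (?N x ^ 3 * of_real (x $ i)) = partial_deriv i ?N x"
      by (simp add: inner_axis)
  qed auto
  moreover have "?N differentiable (at x)" if "x \<noteq> 0" for x
    using D[OF that] unfolding differentiable_def by blast
  ultimately show ?case unfolding Ck_on.simps by blast
qed

lemma Ck_on_norm:
  "Ck_on k (- {0}) (\<lambda>x::real^'n. of_real (norm x) :: 'k::real_normed_field)"
proof -
  have "Ck_on k (- {0}) (\<lambda>x::real^'n. (\<Sum>i\<in>UNIV. of_real (x $ i) * of_real (x $ i)) *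
      of_real (inverse (norm x)) :: 'k)"
    by (intro Ck_on_mult Ck_on_sum Ck_on_coord Ck_on_inverse_norm) auto
  then show ?thesis
  proof (rule Ck_on_cong[rotated])
    fix x :: "real^'n" assume "x \<in> - {0}"
    have "(\<Sum>i\<in>UNIV. of_real (x $ i) * of_real (x $ i)) * of_real (inverse (norm x)) =
      (of_real ((x \<bullet> x) * inverse (norm x)) :: 'k)" by (simp add: inner_vec_def)
    also have "(x \<bullet> x) * inverse (norm x) = norm x"
      using \<open>x \<in> - {0}\<close> by (simp add: dot_square_norm power2_eq_square)
    finally show "(\<Sum>i\<in>UNIV. of_real (x $ i) * of_real (x $ i)) * of_real (inverse (norm x)) =
      (of_real (norm x) :: 'k)" .
  qed auto
qed

lemma open_radial_cone:
  assumes "open U"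
  shows "open {x::'a::real_normed_vector. x \<noteq> 0 \<and> x /\<^sub>R norm x \<in> U}"
proof -
  have "open ((\<lambda>x::'a. x /\<^sub>R norm x) -` U \<inter> (- {0}))"
    by (rule continuous_on_open_vimage[THEN iffD1, rule_format])
      (use assms in \<open>auto intro!: continuous_intros\<close>)
  also have "(\<lambda>x::'a. x /\<^sub>R norm x) -` U \<inter> (- {0}) = {x. x \<noteq> 0 \<and> x /\<^sub>R norm x \<in> U}" by auto
  finally show ?thesis .
qed

text \<open>By the chain rule a partial derivative of the extension is a sum of products: one factor
  is built from coordinates and the inverse norm, the other is the radial extension of a partial
  derivative of \<open>F\<close>. The induction hypothesis, for arbitrary \<open>F\<close>, covers
  the latter.\<close>

lemma Ck_on_radial_extension:
  fixes F :: "real^'n \<Rightarrow> 'k::real_normed_field"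
  assumes U: "open U" and "Ck_on k U F"
  shows "Ck_on k {x. x \<noteq> 0 \<and> x /\<^sub>R norm x \<in> U} (\<lambda>x. F (x /\<^sub>R norm x))"
  using assms(2)
proof (induction k arbitrary: F)
  case 0
  then show ?case
    by (auto intro!: continuous_on_compose2[of U F] continuous_intros)
next
  case (Suc k)
  let ?V = "{x. x \<noteq> 0 \<and> x /\<^sub>R norm x \<in> U}"
  let ?g = "\<lambda>x::real^'n. x /\<^sub>R norm x"
  let ?N = "\<lambda>x::real^'n. of_real (inverse (norm x)) :: 'k"
  have V: "open ?V" by (rule open_radial_cone[OF U])
  have D: "((\<lambda>x. F (?g x)) has_derivative (\<lambda>h. \<Sum>j\<in>UNIV.
      (inverse (norm x) *\<^sub>R h - (inverse (norm x) ^ 3 * (x \<bullet> h)) *\<^sub>R x) $ j *\<^sub>R partial_deriv j F (?g x))) (at x)"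
    if x: "x \<in> ?V" for x
  proof -
    have "(?g has_derivative (\<lambda>h. inverse (norm x) *\<^sub>R h + (- (inverse (norm x) ^ 3 * (x \<bullet> h))) *\<^sub>R x)) (at x)"
      using x by (intro has_derivative_scaleR has_derivative_ident has_derivative_inverse_norm) auto
    then have g: "(?g has_derivative (\<lambda>h. inverse (norm x) *\<^sub>R h - (inverse (norm x) ^ 3 * (x \<bullet> h)) *\<^sub>R x)) (at x)"
      by simp
    have "(F has_derivative (\<lambda>h. \<Sum>j\<in>UNIV. h $ j *\<^sub>R partial_deriv j F (?g x))) (at (?g x))"
      using Suc.prems x by (intro has_derivative_partials) auto
    from diff_chain_at[OF g this] show ?thesis by (simp add: o_def)
  qed
  have IH: "Ck_on k ?V (\<lambda>x. partial_deriv j F (?g x))" for j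
    by (rule Suc.IH) (use Suc.prems in simp)
  have "Ck_on k ?V (\<lambda>x. \<Sum>j\<in>UNIV. (of_real (axis i 1 $ j) * ?N x +
      (- 1) * (?N x ^ 3 * of_real (x $ i) * of_real (x $ j))) * partial_deriv j F (?g x))" for i
    by (intro Ck_on_sum Ck_on_mult Ck_on_add Ck_on_power Ck_on_const Ck_on_coord V IH
        Ck_on_subset[OF Ck_on_inverse_norm]) auto
  then have "Ck_on k ?V (partial_deriv i (\<lambda>x. F (?g x)))" for i
  proof (rule Ck_on_cong[OF V])
    fix x assume x: "x \<in> ?V"
    show "(\<Sum>j\<in>UNIV. (of_real (axis i 1 $ j) * ?N x +
        (- 1) * (?N x ^ 3 * of_real (x $ i) * of_real (x $ j))) * partial_deriv j F (?g x)) =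
      partial_deriv i (\<lambda>x. F (?g x)) x"
      unfolding partial_deriv_eq[OF D[OF x]]
    proof (rule sum.cong[OF refl])
      fix j
      let ?p = "partial_deriv j F (?g x)"
      have "(inverse (norm x) *\<^sub>R axis i 1 - (inverse (norm x) ^ 3 * (x \<bullet> axis i 1)) *\<^sub>R x) $ j =
          axis i 1 $ j * inverse (norm x) - inverse (norm x) ^ 3 * x $ i * x $ j"
        by (simp add: inner_axis)
      then show "(of_real (axis i 1 $ j) * ?N x + (- 1) * (?N x ^ 3 * of_real (x $ i) * of_real (x $ j))) * ?p =
        (inverse (norm x) *\<^sub>R axis i 1 - (inverse (norm x) ^ 3 * (x \<bullet> axis i 1)) *\<^sub>R x) $ j *\<^sub>R ?p"
        by (simp only: scaleR_conv_of_real of_real_diff of_real_mult of_real_power) simp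
    qed
  qed
  moreover have "(\<lambda>x. F (?g x)) differentiable (at x)" if "x \<in> ?V" for x
    using D[OF that] unfolding differentiable_def by blast
  ultimately show ?case by simp
qed

section \<open>Taylor polynomials with uniform remainder\<close>

text \<open>The \<open>k\<close>-th derivative of \<open>F\<close> at \<open>x\<close> evaluated on
  \<open>k\<close> copies of \<open>u\<close>. Peeling off the innermost partial derivative matches
  the recursion of \<open>Ck_on\<close>.\<close>

primrec taylor_form :: "nat \<Rightarrow> (real^'n \<Rightarrow> 'k::real_normed_field) \<Rightarrow> real^'n \<Rightarrow> real^'n \<Rightarrow> 'k" where
  "taylor_form 0 F x u = F x"
| "taylor_form (Suc k) F x u = (\<Sum>i\<in>UNIV. of_real (u $ i) * taylor_form k (partial_deriv i F) x u)"

lemma hom_poly_taylor_form: "hom_poly k (taylor_form k F x)"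
proof (induction k arbitrary: F)
  case 0
  have "taylor_form 0 F x = (\<lambda>_. F x)" by auto
  then show ?case by (simp add: hom_poly.const)
next
  case (Suc k)
  have "hom_poly (Suc k) (\<lambda>u. \<Sum>i\<in>UNIV. of_real (u $ i) * taylor_form k (partial_deriv i F) x u)"
    by (intro hom_poly_sum hom_poly.coord Suc.IH)
  then show ?case by simp
qed

text \<open>The index \<open>m\<close> is the order of the remainder, so the degree is at most
  \<open>m - 1\<close>; the empty sum at \<open>m = 0\<close> makes mere boundedness of
  \<open>F\<close> the base case of \<open>taylor_remainder\<close>.\<close>

definition taylor_poly :: "nat \<Rightarrow> (real^'n \<Rightarrow> 'k::real_normed_field) \<Rightarrow> real^'n \<Rightarrow> real^'n \<Rightarrow> 'k" where
  "taylor_poly m F x u = (\<Sum>k<m. taylor_form k F x u / of_nat (fact k))"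

text \<open>Along a ray, the Taylor remainder of order \<open>m + 1\<close> of \<open>F\<close> has the derivative
  \<open>\<Sum>\<^sub>i u\<^sub>i R\<^sub>i\<close>, where \<open>R\<^sub>i\<close> is the remainder of order \<open>m\<close> of the \<open>i\<close>-th partial derivative.\<close>

lemma taylor_remainder:
  fixes F :: "real^'n \<Rightarrow> 'k::real_normed_field"
  assumes "Ck_on m U F" "compact S" "convex S" "S \<subseteq> U"
  shows "\<exists>B\<ge>0. \<forall>x\<in>S. \<forall>u. x + u \<in> S \<longrightarrow> norm (F (x + u) - taylor_poly m F x u) \<le> B * norm u ^ m"
  using assms(1)
proof (induction m arbitrary: F)
  case 0
  then have "compact (F ` S)"
    using assms by (auto intro: compact_continuous_image continuous_on_subset)
  then obtain B where "\<forall>x\<in>S. norm (F x) \<le> B"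
    by (meson bounded_iff compact_imp_bounded image_eqI)
  then show ?case
    by (intro exI[of _ "max B 0"]) (auto simp: taylor_poly_def le_max_iff_disj)
next
  case (Suc m)
  have "\<forall>i. \<exists>B\<ge>0. \<forall>x\<in>S. \<forall>u. x + u \<in> S \<longrightarrow>
      norm (partial_deriv i F (x + u) - taylor_poly m (partial_deriv i F) x u) \<le> B * norm u ^ m"
    using Suc.prems by (intro allI Suc.IH) simp
  from choice[OF this] obtain B where B: "\<And>i. 0 \<le> B i"
    "\<And>i x u. x \<in> S \<Longrightarrow> x + u \<in> S \<Longrightarrow>
      norm (partial_deriv i F (x + u) - taylor_poly m (partial_deriv i F) x u) \<le> B i * norm u ^ m"
    by blast
  have "norm (F (x + u) - taylor_poly (Suc m) F x u) \<le> (\<Sum>i\<in>UNIV. B i) * norm u ^ Suc m"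
    if x: "x \<in> S" and xu: "x + u \<in> S" for x u
  proof -
    have seg: "x + t *\<^sub>R u \<in> S" if "t \<in> {0..1}" for t
    proof -
      have "(1 - t) *\<^sub>R x + t *\<^sub>R (x + u) \<in> S"
        using that by (intro convexD[OF assms(3)] x xu) auto
      then show ?thesis by (simp add: algebra_simps)
    qed
    define r where "r t = F (x + t *\<^sub>R u) - taylor_poly (Suc m) F x (t *\<^sub>R u)" for t
    define d where "d t = (\<Sum>i\<in>UNIV. of_real (u $ i) *
      (partial_deriv i F (x + t *\<^sub>R u) - taylor_poly m (partial_deriv i F) x (t *\<^sub>R u)))" for t
    have deriv: "(r has_derivative (\<lambda>h. h *\<^sub>R d t)) (at t within {0..1})" if t: "t \<in> {0..1}" for t
    proof -
      have line: "((\<lambda>t. x + t *\<^sub>R u) has_derivative (\<lambda>h. h *\<^sub>R u)) (at t within {0..1})"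
        by (auto intro!: derivative_eq_intros)
      have F: "(F has_derivative (\<lambda>h. \<Sum>i\<in>UNIV. h $ i *\<^sub>R partial_deriv i F (x + t *\<^sub>R u)))
          (at (x + t *\<^sub>R u) within (\<lambda>t. x + t *\<^sub>R u) ` {0..1})"
      proof (rule has_derivative_at_withinI[OF has_derivative_partials])
        have "x + t *\<^sub>R u \<in> U" using seg[OF t] assms(4) by blast
        then show "F differentiable (at (x + t *\<^sub>R u))" using Suc.prems unfolding Ck_on.simps by blast
      qed
      have 1: "((\<lambda>t. F (x + t *\<^sub>R u)) has_derivative
          (\<lambda>h. \<Sum>i\<in>UNIV. (h *\<^sub>R u) $ i *\<^sub>R partial_deriv i F (x + t *\<^sub>R u))) (at t within {0..1})"
        using diff_chain_within[OF line F] unfolding o_def .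
      have form_scale: "taylor_form k G x (t *\<^sub>R u) / of_nat (fact k) =
          t ^ k *\<^sub>R (taylor_form k G x u / of_nat (fact k))" for k t and G :: "real^'n \<Rightarrow> 'k"
        unfolding hom_poly_scaleR[OF hom_poly_taylor_form] by (simp add: scaleR_conv_of_real)
      have tp: "taylor_poly (Suc m) F x (t *\<^sub>R u) =
          F x + (\<Sum>k<m. t ^ Suc k *\<^sub>R (taylor_form (Suc k) F x u / of_nat (fact (Suc k))))" for t
        unfolding taylor_poly_def form_scale by (subst sum.lessThan_Suc_shift) simp
      have 2: "((\<lambda>t. taylor_poly (Suc m) F x (t *\<^sub>R u)) has_derivative
          (\<lambda>h. \<Sum>k<m. (h * (of_nat (Suc k) * t ^ k)) *\<^sub>R (taylor_form (Suc k) F x u / of_nat (fact (Suc k)))))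
          (at t within {0..1})"
      proof -
        have "((\<lambda>t. t ^ Suc k *\<^sub>R c) has_derivative (\<lambda>h. (h * (of_nat (Suc k) * t ^ k)) *\<^sub>R c))
            (at t within {0..1})" for k and c :: 'k
          using has_derivative_scaleR_left[OF has_derivative_power[OF has_derivative_ident, of "Suc k" t "{0..1}"]]
          by (simp add: mult_ac del: power_Suc)
        then have "((\<lambda>t. F x + (\<Sum>k<m. t ^ Suc k *\<^sub>R (taylor_form (Suc k) F x u / of_nat (fact (Suc k)))))
          has_derivative
          (\<lambda>h. 0 + (\<Sum>k<m. (h * (of_nat (Suc k) * t ^ k)) *\<^sub>R (taylor_form (Suc k) F x u / of_nat (fact (Suc k))))))
          (at t within {0..1})"
          by (intro has_derivative_add has_derivative_const has_derivative_sum)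
        then show ?thesis unfolding tp by simp
      qed
      \<comment> \<open>The factor \<open>Suc k\<close> from differentiating
        \<open>t ^ Suc k\<close> reduces \<open>fact (Suc k)\<close> to \<open>fact k\<close>, which
        leaves the Taylor polynomials of the partial derivatives.\<close>
      have "(\<Sum>k<m. (h * (of_nat (Suc k) * t ^ k)) *\<^sub>R (taylor_form (Suc k) F x u / of_nat (fact (Suc k))))
         = h *\<^sub>R (\<Sum>i\<in>UNIV. of_real (u $ i) * taylor_poly m (partial_deriv i F) x (t *\<^sub>R u))" for h
      proof -
        have "(h * (of_nat (Suc k) * t ^ k)) *\<^sub>R (taylor_form (Suc k) F x u / of_nat (fact (Suc k))) =
            h *\<^sub>R (\<Sum>i\<in>UNIV. of_real (u $ i) *
              (taylor_form k (partial_deriv i F) x (t *\<^sub>R u) / of_nat (fact k)))" for k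
        proof -
          have "(of_nat (fact (Suc k)) :: 'k) = of_nat (Suc k) * of_nat (fact k)"
            by (simp only: fact_Suc of_nat_mult of_nat_id)
          moreover have "(of_nat (Suc k) :: 'k) \<noteq> 0" by (simp only: of_nat_eq_0_iff)
          ultimately show ?thesis
            unfolding form_scale
            by (simp add: scaleR_conv_of_real sum_distrib_left sum_divide_distrib mult_ac del: of_nat_Suc fact_Suc of_nat_fact)
        qed
        then show ?thesis
          by (simp add: taylor_poly_def sum_distrib_left scaleR_sum_right sum.swap[of _ UNIV])
      qed
      moreover have "(h *\<^sub>R u) $ i *\<^sub>R p = h *\<^sub>R (of_real (u $ i) * p)" for h i and p :: 'k
        unfolding vector_scaleR_component by (simp add: scaleR_conv_of_real)
      ultimately have 3: "(\<lambda>h. (\<Sum>i\<in>UNIV. (h *\<^sub>R u) $ i *\<^sub>R partial_deriv i F (x + t *\<^sub>R u)) -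
          (\<Sum>k<m. (h * (of_nat (Suc k) * t ^ k)) *\<^sub>R (taylor_form (Suc k) F x u / of_nat (fact (Suc k)))))
          = (\<lambda>h. h *\<^sub>R d t)"
        by (simp only: d_def right_diff_distrib sum_subtractf scaleR_diff_right scaleR_sum_right)
      show ?thesis
        using has_derivative_diff[OF 1 2] unfolding r_def 3 .
    qed
    have bound: "norm (d t) \<le> (\<Sum>i\<in>UNIV. B i) * norm u ^ Suc m" if t: "t \<in> {0..1}" for t
    proof -
      have "norm (d t) \<le> (\<Sum>i\<in>UNIV. norm u * (B i * norm u ^ m))"
        unfolding d_def
      proof (rule sum_norm_le)
        fix i
        have "norm (partial_deriv i F (x + t *\<^sub>R u) - taylor_poly m (partial_deriv i F) x (t *\<^sub>R u))
            \<le> B i * norm (t *\<^sub>R u) ^ m"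
          by (rule B(2)[OF x seg[OF t]])
        also have "\<dots> \<le> B i * norm u ^ m"
          using t by (intro mult_left_mono power_mono B(1)) (auto intro: mult_left_le_one_le)
        finally show "norm (of_real (u $ i) * (partial_deriv i F (x + t *\<^sub>R u) -
            taylor_poly m (partial_deriv i F) x (t *\<^sub>R u))) \<le> norm u * (B i * norm u ^ m)"
          unfolding norm_mult using component_le_norm_cart[of u i] by (intro mult_mono) auto
      qed
      also have "\<dots> = (\<Sum>i\<in>UNIV. B i) * norm u ^ Suc m"
        by (simp add: sum_distrib_left sum_distrib_right mult_ac)
      finally show ?thesis .
    qed
    \<comment> \<open>Mean value estimate along the segment; \<open>r 1\<close> is the remainder at
      \<open>u\<close>, and \<open>r 0\<close> vanishes.\<close>
    have "norm (r 1 - r 0) \<le> (\<Sum>i\<in>UNIV. B i) * norm u ^ Suc m * norm (1 - 0 :: real)"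
    proof (rule differentiable_bound[where S = "{0..1}" and f' = "\<lambda>t h. h *\<^sub>R d t"])
      show "onorm (\<lambda>h. h *\<^sub>R d t) \<le> (\<Sum>i\<in>UNIV. B i) * norm u ^ Suc m" if "t \<in> {0..1}" for t
      proof (rule onorm_bound)
        show "0 \<le> (\<Sum>i\<in>UNIV. B i) * norm u ^ Suc m" using B(1) by (intro mult_nonneg_nonneg sum_nonneg) auto
        show "norm (h *\<^sub>R d t) \<le> (\<Sum>i\<in>UNIV. B i) * norm u ^ Suc m * norm h" for h
          using mult_right_mono[OF bound[OF that], of "norm h"] by (simp add: mult_ac)
      qed
    qed (use deriv in auto)
    moreover have "r 0 = 0"
    proof -
      have "taylor_form (Suc k) F x 0 = 0" for k by simp
      then show ?thesis
        unfolding r_def taylor_poly_def sum.lessThan_Suc_shift by (simp del: taylor_form.simps(2)) 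
    qed
    ultimately show ?thesis by (simp add: r_def)
  qed
  then show ?case
    using B(1) by (intro exI[of _ "\<Sum>i\<in>UNIV. B i"]) (auto intro: sum_nonneg)
qed

text \<open>The Taylor polynomial is taken of \<open>G x = \<bar>x\<bar>\<^sup>L f (x / \<bar>x\<bar>)\<close> on the tangent plane at \<open>y\<close>, and
  \<open>p\<close> is its homogenisation; since \<open>G\<close> is homogeneous of the same degree, the error on the
  sphere is that on the tangent plane.\<close>

lemma Ck_sphere_approx_local:
  fixes f :: "real^'n \<Rightarrow> 'k::real_normed_field"
  assumes f: "Ck_sphere (Suc L) f" and y0: "y0 \<in> sphere 0 1"
  shows "\<exists>\<rho>>0. \<exists>B\<ge>0. \<forall>y\<in>sphere 0 1. norm (y - y0) < \<rho> \<longrightarrow>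
    (\<exists>p. hom_poly L p \<and>
      (\<forall>x\<in>sphere 0 1. norm (x - y) \<le> \<rho> \<longrightarrow> norm (f x - p x) \<le> B * norm (x - y) ^ Suc L))"
proof -
  from f[unfolded Ck_sphere_def, rule_format, OF y0]
  obtain U F where U: "open U" "y0 \<in> U" and F: "Ck_on (Suc L) U F"
    and Ff: "\<forall>x\<in>U \<inter> sphere 0 1. F x = f x"
    by (elim exE conjE) (rule that)
  define V where "V = {x. x \<noteq> 0 \<and> x /\<^sub>R norm x \<in> U}"
  define G where "G x = of_real (norm x) ^ L * F (x /\<^sub>R norm x)" for x
  have V: "open V" unfolding V_def by (rule open_radial_cone[OF U(1)])
  have "Ck_on (Suc L) V (\<lambda>x. of_real (norm x) :: 'k)"
    by (rule Ck_on_subset[OF Ck_on_norm]) (auto simp: V_def)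
  then have G: "Ck_on (Suc L) V G"
    unfolding G_def[abs_def] V_def
    by (intro Ck_on_mult Ck_on_power Ck_on_radial_extension F U(1) open_radial_cone)
  have "y0 \<in> V" using y0 U(2) by (auto simp: V_def)
  with V obtain r where r: "0 < r" "cball y0 r \<subseteq> V" by (meson open_contains_cball)
  obtain B where B: "0 \<le> B" "\<And>x u. x \<in> cball y0 r \<Longrightarrow> x + u \<in> cball y0 r \<Longrightarrow>
      norm (G (x + u) - taylor_poly (Suc L) G x u) \<le> B * norm u ^ Suc L"
    using taylor_remainder[OF G compact_cball convex_cball r(2)] by blast
  \<comment> \<open>The projected point \<open>y + u\<close> is within \<open>3 * \<rho>\<close> of
    \<open>y0\<close>, hence in the ball of radius \<open>r\<close>. The bound 1 ensures that
    \<open>x \<bullet> y\<close> is at least 1/2.\<close>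
  define \<rho> where "\<rho> = min (r / 4) 1"
  have \<rho>: "0 < \<rho>" "\<rho> \<le> 1" "3 * \<rho> \<le> r" using r(1) by (auto simp: \<rho>_def)
  have "\<exists>p. hom_poly L p \<and>
      (\<forall>x\<in>sphere 0 1. norm (x - y) \<le> \<rho> \<longrightarrow> norm (f x - p x) \<le> (B * 2 ^ Suc L) * norm (x - y) ^ Suc L)"
    if y: "y \<in> sphere 0 1" and yy0: "norm (y - y0) < \<rho>" for y
  proof -
    have ny: "norm y = 1" "y \<bullet> y = 1" using y by (auto simp: dot_square_norm)
    \<comment> \<open>The factor with exponent \<open>L - k\<close> lifts the Taylor term of degree
      \<open>k\<close> to degree \<open>L\<close> and equals 1 on the tangent plane. Separating
      \<open>x\<close> from \<open>u\<close> allows the tangential part of \<open>x\<close> to be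
      rewritten as \<open>s *\<^sub>R u\<close> later.\<close>
    define P where "P x u = (\<Sum>k<Suc L. of_real (x \<bullet> y) ^ (L - k) * (1 / of_nat (fact k) * taylor_form k G y u))"
      for x u :: "real^'n"
    define p where "p x = P x (x - (x \<bullet> y) *\<^sub>R y)" for x
    have "hom_poly L (\<lambda>x. of_real (x \<bullet> y) ^ (L - k) *
        (1 / of_nat (fact k) * taylor_form k G y (x - (x \<bullet> y) *\<^sub>R y)))" if "k < Suc L" for k
    proof -
      have "linear (\<lambda>x. x \<bullet> y)"
        by (rule linearI) (auto simp: inner_add_left)
      then have 1: "hom_poly (L - k) (\<lambda>x. of_real (x \<bullet> y) ^ (L - k))"
        using hom_poly_power[OF hom_poly_linear_form] by fastforce
      have "linear (\<lambda>x. x - (x \<bullet> y) *\<^sub>R y)"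
        by (rule linearI) (auto simp: inner_add_left algebra_simps)
      from hom_poly_mult[OF 1 hom_poly_cmult[OF hom_poly_compose_linear[OF hom_poly_taylor_form this]]]
      have "hom_poly (L - k + k) (\<lambda>x. of_real (x \<bullet> y) ^ (L - k) *
        (1 / of_nat (fact k) * taylor_form k G y (x - (x \<bullet> y) *\<^sub>R y)))" .
      with that show ?thesis by simp
    qed
    then have p: "hom_poly L p"
      unfolding p_def[abs_def] P_def by (intro hom_poly_sum) simp
    have "norm (f x - p x) \<le> (B * 2 ^ Suc L) * norm (x - y) ^ Suc L"
      if x: "x \<in> sphere 0 1" and xy: "norm (x - y) \<le> \<rho>" for x
    proof -
      have nx: "norm x = 1" using x by simp
      define s where "s = x \<bullet> y"
      \<comment> \<open>The point \<open>y + u\<close> is the central projection of \<open>x\<close>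
        onto the tangent plane. The tangential part of \<open>x\<close> is \<open>s\<close> times
        \<open>u\<close> and no longer than the chord, so \<open>u\<close> is at most twice as long
        as \<open>x - y\<close>.\<close>
      define u where "u = x /\<^sub>R s - y"
      have s: "s = 1 - (norm (x - y))\<^sup>2 / 2"
        unfolding s_def by (rule inner_unit_eq[OF nx ny(1)])
      moreover have "(norm (x - y))\<^sup>2 \<le> 1"
        using xy \<rho> by (intro power_le_one) auto
      ultimately have s2: "1 / 2 \<le> s" "s \<le> 1" by auto
      have su: "x - s *\<^sub>R y = s *\<^sub>R u" using s2 by (simp add: u_def algebra_simps)
      have "(norm (x - s *\<^sub>R y))\<^sup>2 = 1 - s\<^sup>2"
      proof -
        have "x \<bullet> x = 1" "y \<bullet> x = s" "x \<bullet> y = s"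
          using nx by (simp_all add: norm_eq_1 s_def inner_commute)
        then show ?thesis
          unfolding power2_norm_eq_inner inner_diff_left inner_diff_right inner_scaleR_left inner_scaleR_right
          using ny by (simp add: power2_eq_square)
      qed
      also have "\<dots> = (1 - s) * (1 + s)" by (simp add: power2_eq_square algebra_simps)
      also have "\<dots> \<le> (1 - s) * 2" using s2 by (intro mult_left_mono) auto
      also have "\<dots> = (norm (x - y))\<^sup>2" using s by simp
      finally have "norm (x - s *\<^sub>R y) \<le> norm (x - y)" by (rule power2_le_imp_le) simp
      moreover have "norm (x - s *\<^sub>R y) = s * norm u" unfolding su using s2 by simp
      moreover have "1 / 2 * norm u \<le> s * norm u" using s2 by (intro mult_right_mono) auto
      ultimately have nu: "norm u \<le> 2 * norm (x - y)" by linarith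
      have yb: "y \<in> cball y0 r" using yy0 \<rho> by (simp add: dist_norm norm_minus_commute)
      have "norm (y + u - y0) \<le> norm (y - y0) + norm u"
        using norm_triangle_ineq[of "y - y0" u] by (simp add: algebra_simps)
      then have yub: "y + u \<in> cball y0 r"
        using yy0 nu xy \<rho> by (simp add: dist_norm norm_minus_commute)
      have yu: "y + u = x /\<^sub>R s" by (simp add: u_def)
      have s0: "0 < s" using s2 by linarith
      have nyu: "norm (y + u) = 1 / s"
        unfolding yu norm_scaleR nx abs_of_pos[OF positive_imp_inverse_positive[OF s0]]
        by (simp only: mult_1_right inverse_eq_divide)
      have ray: "(y + u) /\<^sub>R norm (y + u) = x"
        unfolding nyu unfolding yu scaleR_scaleR using s0 by simp
      have "y + u \<in> V" using yub r(2) by blast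
      then have "x \<in> U" unfolding V_def using ray by simp
      then have "G (y + u) = of_real (1 / s) ^ L * f x"
        unfolding G_def ray using Ff x by (simp add: nyu)
      then have fx: "f x = of_real s ^ L * G (y + u)"
        using s0 by (simp add: power_divide)
      have "P x (s *\<^sub>R u) = of_real s ^ L * taylor_poly (Suc L) G y u"
        unfolding P_def taylor_poly_def sum_distrib_left
      proof (rule sum.cong[OF refl])
        fix k assume "k \<in> {..<Suc L}"
        then have "of_real s ^ (L - k) * of_real s ^ k = (of_real s ^ L :: 'k)"
          by (simp flip: power_add)
        then show "of_real (x \<bullet> y) ^ (L - k) * (1 / of_nat (fact k) * taylor_form k G y (s *\<^sub>R u)) =
            of_real s ^ L * (taylor_form k G y u / of_nat (fact k))"
          unfolding hom_poly_scaleR[OF hom_poly_taylor_form] s_def[symmetric] of_real_power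
          by (metis (no_types, lifting) mult.assoc mult.commute mult_1 times_divide_eq_left)
      qed
      then have "f x - p x = of_real s ^ L * (G (y + u) - taylor_poly (Suc L) G y u)"
        unfolding fx p_def s_def[symmetric] su by (simp add: right_diff_distrib)
      then have "norm (f x - p x) = s ^ L * norm (G (y + u) - taylor_poly (Suc L) G y u)"
        using s2 by (simp add: norm_mult norm_power)
      also have "\<dots> \<le> 1 * (B * norm u ^ Suc L)"
        using s2 by (intro mult_mono B(2) yb yub power_le_one) auto
      also have "\<dots> \<le> B * (2 * norm (x - y)) ^ Suc L"
        unfolding mult_1 by (intro mult_left_mono power_mono nu B(1)) auto
      finally show ?thesis by (simp only: power_mult_distrib mult.assoc)
    qed
    with p show ?thesis by blast
  qed
  then show ?thesis
    using \<rho>(1) B(1) by (intro exI[of _ \<rho>] conjI exI[of _ "B * 2 ^ Suc L"]) auto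
qed

text \<open>Compactness of the sphere: the local statement has one constant for all centres near
  \<open>y0\<close>, so a finite cover suffices, with the smallest radius and the sum of the
  constants.\<close>

lemma Ck_sphere_approx:
  fixes f :: "real^'n \<Rightarrow> 'k::real_normed_field"
  assumes f: "Ck_sphere (Suc L) f"
  obtains \<rho> B :: real where "0 < \<rho>" "0 \<le> B"
    "\<And>y. y \<in> sphere 0 1 \<Longrightarrow> \<exists>p. hom_poly L p \<and>
      (\<forall>x\<in>sphere 0 1. norm (x - y) \<le> \<rho> \<longrightarrow> norm (f x - p x) \<le> B * norm (x - y) ^ Suc L)"
proof -
  let ?S = "sphere 0 1 :: (real^'n) set"
  have "\<forall>y0\<in>?S. \<exists>\<rho>. \<exists>B. 0 < \<rho> \<and> 0 \<le> B \<and> (\<forall>y\<in>?S. norm (y - y0) < \<rho> \<longrightarrow>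
    (\<exists>p. hom_poly L p \<and>
      (\<forall>x\<in>?S. norm (x - y) \<le> \<rho> \<longrightarrow> norm (f x - p x) \<le> B * norm (x - y) ^ Suc L)))"
    using Ck_sphere_approx_local[OF f] by blast
  from bchoice[OF this] obtain \<rho> where "\<forall>y0\<in>?S. \<exists>B. 0 < \<rho> y0 \<and> 0 \<le> B \<and> (\<forall>y\<in>?S. norm (y - y0) < \<rho> y0 \<longrightarrow>
    (\<exists>p. hom_poly L p \<and>
      (\<forall>x\<in>?S. norm (x - y) \<le> \<rho> y0 \<longrightarrow> norm (f x - p x) \<le> B * norm (x - y) ^ Suc L)))"
    by (elim exE) (rule that)
  from bchoice[OF this] obtain B where *: "\<forall>y0\<in>?S. 0 < \<rho> y0 \<and> 0 \<le> B y0 \<and> (\<forall>y\<in>?S. norm (y - y0) < \<rho> y0 \<longrightarrow>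
    (\<exists>p. hom_poly L p \<and>
      (\<forall>x\<in>?S. norm (x - y) \<le> \<rho> y0 \<longrightarrow> norm (f x - p x) \<le> B y0 * norm (x - y) ^ Suc L)))"
    by (elim exE) (rule that)
  have "?S \<subseteq> (\<Union>y0\<in>?S. ball y0 (\<rho> y0))"
  proof
    fix y assume "y \<in> ?S"
    with * have "0 < \<rho> y" by blast
    then have "y \<in> ball y (\<rho> y)" by simp
    with \<open>y \<in> ?S\<close> show "y \<in> (\<Union>y0\<in>?S. ball y0 (\<rho> y0))" by blast
  qed
  then obtain T where T: "T \<subseteq> ?S" "finite T" "?S \<subseteq> (\<Union>y0\<in>T. ball y0 (\<rho> y0))"
    by (rule compactE_image[OF compact_sphere, rotated]) auto
  define r where "r = Min (insert 1 (\<rho> ` T))"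
  have r: "0 < r" "\<And>y0. y0 \<in> T \<Longrightarrow> r \<le> \<rho> y0"
    using T * by (auto simp: r_def)
  define C where "C = (\<Sum>y0\<in>T. B y0)"
  have C: "B y0 \<le> C" if "y0 \<in> T" for y0
    unfolding C_def using T(1,2) * that by (intro member_le_sum) auto
  show thesis
  proof (rule that[OF r(1)])
    show "0 \<le> C" unfolding C_def using T(1) * by (intro sum_nonneg) auto
    fix y assume y: "y \<in> ?S"
    with T(3) obtain y0 where y0: "y0 \<in> T" "norm (y - y0) < \<rho> y0"
      by (auto simp: dist_norm norm_minus_commute)
    with * T(1) y obtain p where p: "hom_poly L p"
      "\<forall>x\<in>?S. norm (x - y) \<le> \<rho> y0 \<longrightarrow> norm (f x - p x) \<le> B y0 * norm (x - y) ^ Suc L" by blast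
    have "norm (f x - p x) \<le> C * norm (x - y) ^ Suc L" if x: "x \<in> ?S" "norm (x - y) \<le> r" for x
    proof -
      have "norm (f x - p x) \<le> B y0 * norm (x - y) ^ Suc L"
        using p(2) x r(2)[OF y0(1)] by auto
      also have "\<dots> \<le> C * norm (x - y) ^ Suc L" by (intro mult_right_mono C y0) auto
      finally show ?thesis .
    qed
    with p(1) show "\<exists>p. hom_poly L p \<and>
      (\<forall>x\<in>?S. norm (x - y) \<le> r \<longrightarrow> norm (f x - p x) \<le> C * norm (x - y) ^ Suc L)" by blast
  qed
qed

subsection \<open>Convergence\<close>

text \<open>The minimum is at most \<open>K * b * E\<^sup>2\<close>, the value allowed by the
  competitor \<open>q\<close>. A single term of weight at least \<open>a\<close> then gives the
  square root, and the summand 1 comes from \<open>f - q\<close>. Because \<open>q y = f y\<close>,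
  norming \<open>p - q\<close> bounds the error at \<open>y\<close> itself.\<close>

lemma mls_pointwise_error:
  fixes f :: "real^'n \<Rightarrow> 'k::{real_normed_field, euclidean_space}"
  assumes norming: "\<And>(p :: real^'n \<Rightarrow> 'k) M. hom_poly L p \<Longrightarrow>
      (\<And>z. z \<in> Y \<Longrightarrow> norm (z - y) \<le> \<delta> / 8 \<Longrightarrow> norm (p z) \<le> M) \<Longrightarrow>
      norm (p y) \<le> C * M \<and> (M = 0 \<longrightarrow> (\<forall>z. p z = 0))"
    and Y: "finite Y" "Y \<subseteq> sphere 0 1" and y: "y \<in> sphere 0 1" and "0 < \<delta>" "0 \<le> C"
    and w_nonneg: "\<And>z. z \<in> Y \<Longrightarrow> 0 \<le> w y z"
    and w_le: "\<And>z. z \<in> Y \<Longrightarrow> w y z \<le> b"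
    and w_zero: "\<And>z. z \<in> Y \<Longrightarrow> \<delta> < norm (z - y) \<Longrightarrow> w y z = 0"
    and w_ge: "\<And>z. z \<in> Y \<Longrightarrow> norm (z - y) \<le> \<delta> / 8 \<Longrightarrow> a \<le> w y z" and a: "0 < a"
    and b: "0 \<le> b"
    and card: "card {z \<in> Y. norm (z - y) \<le> \<delta>} \<le> K"
    and q: "hom_poly L q" "q y = f y" and E: "0 \<le> E"
      "\<And>x. x \<in> sphere 0 1 \<Longrightarrow> norm (x - y) \<le> \<delta> \<Longrightarrow> norm (f x - q x) \<le> E"
  shows "\<exists>!g. mls_solution (H2_space L) Y w f y g"
    "norm (f y - mls_approx (H2_space L) Y w f y) \<le> C * ((sqrt (K * b / a) + 1) * E)"
proof -
  have unisolvent: "\<forall>z. p z = 0"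
    if "hom_poly L p" "\<And>z. z \<in> Y \<Longrightarrow> 0 < w y z \<Longrightarrow> p z = 0" for p :: "real^'n \<Rightarrow> 'k"
  proof -
    have "norm (p z) \<le> 0" if "z \<in> Y" "norm (z - y) \<le> \<delta> / 8" for z
      using \<open>\<And>z. z \<in> Y \<Longrightarrow> 0 < w y z \<Longrightarrow> p z = 0\<close>[OF that(1)] w_ge[OF that] a by simp
    from norming[OF \<open>hom_poly L p\<close> this] show ?thesis by simp
  qed
  show "\<exists>!g. mls_solution (H2_space L) Y w f y g"
    by (rule mls_solution_H2_space(1)[where f = f and w = w and y = y, OF Y w_nonneg unisolvent])
  obtain p where p: "hom_poly L p"
    and p_eq: "(THE g. mls_solution (H2_space L) Y w f y g) = restrict p (sphere 0 1)"
    and min: "\<forall>q. hom_poly L q \<longrightarrow>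
      (\<Sum>z\<in>Y. w y z * (norm (f z - p z))\<^sup>2) \<le> (\<Sum>z\<in>Y. w y z * (norm (f z - q z))\<^sup>2)"
    using mls_solution_H2_space(2)[where f = f and w = w and y = y, OF Y w_nonneg unisolvent] by blast
  let ?Z = "{z \<in> Y. norm (z - y) \<le> \<delta>}"
  have "(\<Sum>z\<in>Y. w y z * (norm (f z - q z))\<^sup>2) = (\<Sum>z\<in>?Z. w y z * (norm (f z - q z))\<^sup>2)"
  proof (rule sum.mono_neutral_right[OF Y(1)])
    have "w y z = 0" if "z \<in> Y - ?Z" for z by (rule w_zero) (use that in auto)
    then show "\<forall>z\<in>Y - ?Z. w y z * (norm (f z - q z))\<^sup>2 = 0" by simp
  qed auto
  also have "\<dots> \<le> of_nat (card ?Z) * (b * E\<^sup>2)"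
  proof (rule sum_bounded_above)
    fix z assume "z \<in> ?Z"
    then show "w y z * (norm (f z - q z))\<^sup>2 \<le> b * E\<^sup>2"
      using w_le b Y(2) by (intro mult_mono power_mono E) auto
  qed
  also have "\<dots> \<le> K * (b * E\<^sup>2)"
    using card b by (intro mult_right_mono) auto
  finally have Jp: "(\<Sum>z\<in>Y. w y z * (norm (f z - p z))\<^sup>2) \<le> K * (b * E\<^sup>2)"
    using min q(1) by fastforce
  have "norm (p z - q z) \<le> (sqrt (K * b / a) + 1) * E" if z: "z \<in> Y" "norm (z - y) \<le> \<delta> / 8" for z
  proof -
    have "a * (norm (f z - p z))\<^sup>2 \<le> w y z * (norm (f z - p z))\<^sup>2"
      by (intro mult_right_mono w_ge z) auto
    also have "\<dots> \<le> (\<Sum>z\<in>Y. w y z * (norm (f z - p z))\<^sup>2)"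
      using w_nonneg by (intro member_le_sum z Y) auto
    finally have "(norm (f z - p z))\<^sup>2 \<le> K * b / a * E\<^sup>2"
      using Jp a by (simp add: field_simps)
    also have "\<dots> = (sqrt (K * b / a) * E)\<^sup>2"
      using a b by (simp add: power_mult_distrib)
    finally have "norm (f z - p z) \<le> sqrt (K * b / a) * E"
      by (rule power2_le_imp_le) (use a b E(1) in auto)
    moreover have "norm (f z - q z) \<le> E"
      using z Y \<open>0 < \<delta>\<close> by (intro E) auto
    moreover have "norm (p z - q z) \<le> norm (f z - q z) + norm (f z - p z)"
      using norm_triangle_ineq4[of "f z - q z" "f z - p z"] by simp
    ultimately show ?thesis by (simp add: distrib_right)
  qed
  from norming[OF hom_poly_diff[OF p q(1)] this]
  have "norm (p y - q y) \<le> C * ((sqrt (K * b / a) + 1) * E)" by blast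
  then show "norm (f y - mls_approx (H2_space L) Y w f y) \<le> C * ((sqrt (K * b / a) + 1) * E)"
    using y by (simp add: mls_approx_def p_eq q(2) norm_minus_commute)
qed

text \<open>Extreme values on two compact intervals; beyond 1 the function is 0.\<close>

lemma weight_function_bounds:
  fixes \<phi> :: "real \<Rightarrow> real"
  assumes "continuous_on {0..} \<phi>" "\<And>t. 0 \<le> t \<Longrightarrow> t \<le> 1 / 2 \<Longrightarrow> 0 < \<phi> t" "\<And>t. 1 \<le> t \<Longrightarrow> \<phi> t = 0"
  obtains a b where "0 < a" "0 \<le> b" "\<And>t. 0 \<le> t \<Longrightarrow> t \<le> 1 / 2 \<Longrightarrow> a \<le> \<phi> t"
    "\<And>t. 0 \<le> t \<Longrightarrow> \<phi> t \<le> b"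
proof -
  have "continuous_on {0..1/2} \<phi>" "continuous_on {0..1} \<phi>"
    by (rule continuous_on_subset[OF assms(1)], force)+
  then obtain s t where s: "s \<in> {0..1/2}" "\<forall>x\<in>{0..1/2}. \<phi> s \<le> \<phi> x"
    and t: "t \<in> {0..1}" "\<forall>x\<in>{0..1}. \<phi> x \<le> \<phi> t"
    using continuous_attains_inf[of "{0..1/2}" \<phi>] continuous_attains_sup[of "{0..1}" \<phi>]
    by (auto simp del: atLeastAtMost_iff)
  show thesis
  proof (rule that[of "\<phi> s" "max 0 (\<phi> t)"])
    show "0 < \<phi> s" using s assms(2) by auto
    show "\<phi> x \<le> max 0 (\<phi> t)" if "0 \<le> x" for x
      using t that assms(3)[of x] by (cases "x \<le> 1") (auto simp: le_max_iff_disj)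
  qed (use s in auto)
qed

text \<open>The scalar class has real and complex numbers as instances and supplies the real inner
  product for least squares.\<close>

lemma mls_convergence:
  fixes L :: nat and \<phi> :: "real \<Rightarrow> real"
  assumes dim: "2 \<le> CARD('n::finite)"
    and phi_cont: "continuous_on {0..} \<phi>"
    and phi_nonneg: "\<And>t. 0 \<le> t \<Longrightarrow> 0 \<le> \<phi> t"
    and phi_pos: "\<And>t. 0 \<le> t \<Longrightarrow> t \<le> 1 / 2 \<Longrightarrow> 0 < \<phi> t"
    and phi_zero: "\<And>t. 1 \<le> t \<Longrightarrow> \<phi> t = 0"
  shows "\<exists>r>0. \<forall>(c::real) (Y :: nat \<Rightarrow> (real^'n) set) (R::real) (w :: nat \<Rightarrow> real^'n \<Rightarrow> real^'n \<Rightarrow> real).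
    0 < c \<longrightarrow>
    (\<forall>l. node_set (Y l)) \<longrightarrow>
    (\<forall>l. fill_dist (Y l) / sep_dist (Y l) \<le> c) \<longrightarrow>
    (\<lambda>l. fill_dist (Y l)) \<longlonglongrightarrow> 0 \<longrightarrow>
    r \<le> R \<longrightarrow>
    w = (\<lambda>l y z. \<phi> (gc_dist y z / (R * fill_dist (Y l)))) \<longrightarrow>
      (\<forall>f :: real^'n \<Rightarrow> 'k::{real_normed_field, euclidean_space}. Ck_sphere (L + 1) f \<longrightarrow>
        (\<forall>\<^sub>F l in sequentially. mls_well_defined (H2_space L) (Y l) (w l) f) \<and>
        (\<lambda>l. sphere_norm (\<lambda>y. f y - mls_approx (H2_space L) (Y l) (w l) f y))
          \<in> O(\<lambda>l. fill_dist (Y l) ^ (L + 1)))"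
proof -
  let ?S = "sphere 0 1 :: (real^'n) set"
  obtain \<eta> C :: real where \<eta>: "0 < \<eta>" and C: "0 \<le> C"
    and norming: "\<And>(p :: real^'n \<Rightarrow> 'k) Y \<delta> y M. hom_poly L p \<Longrightarrow> Y \<subseteq> ?S \<Longrightarrow>
      0 < \<delta> \<Longrightarrow> \<delta> \<le> 1 \<Longrightarrow> y \<in> ?S \<Longrightarrow>
      (\<And>x. x \<in> ?S \<Longrightarrow> \<exists>z\<in>Y. norm (z - x) \<le> \<eta> * \<delta>) \<Longrightarrow>
      (\<And>z. z \<in> Y \<Longrightarrow> norm (z - y) \<le> \<delta> / 8 \<Longrightarrow> norm (p z) \<le> M) \<Longrightarrow>
      norm (p y) \<le> C * M \<and> (M = 0 \<longrightarrow> (\<forall>z. p z = 0))"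
    by (rule sphere_norming[where 'n = 'n and 'k = 'k and L = L]) blast
  obtain a b where a: "0 < a" and b: "0 \<le> b" and phi_ge: "\<And>t. 0 \<le> t \<Longrightarrow> t \<le> 1 / 2 \<Longrightarrow> a \<le> \<phi> t"
    and phi_le: "\<And>t. 0 \<le> t \<Longrightarrow> \<phi> t \<le> b"
    using weight_function_bounds[OF phi_cont phi_pos phi_zero] by blast
  show ?thesis
  \<comment> \<open>For \<open>R\<close> above this threshold the fill distance is at most
    \<open>\<eta> * \<delta>\<close>, the density required by \<open>sphere_norming\<close>. The
    value is fixed before \<open>c\<close>, the nodes and \<open>f\<close>.\<close>
  proof (intro exI[of _ "1 / \<eta>"] conjI[of "0 < 1 / \<eta>"] allI impI)
    show "0 < 1 / \<eta>" using \<eta> by simp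
    fix c R :: real and Y :: "nat \<Rightarrow> (real^'n) set" and w :: "nat \<Rightarrow> real^'n \<Rightarrow> real^'n \<Rightarrow> real"
      and f :: "real^'n \<Rightarrow> 'k"
    assume c: "0 < c" and Y': "\<forall>l. node_set (Y l)" and ratio: "\<forall>l. fill_dist (Y l) / sep_dist (Y l) \<le> c"
      and lim: "(\<lambda>l. fill_dist (Y l)) \<longlonglongrightarrow> 0" and R: "1 / \<eta> \<le> R"
      and w: "w = (\<lambda>l y z. \<phi> (gc_dist y z / (R * fill_dist (Y l))))" and f: "Ck_sphere (L + 1) f"
    note Y = Y'[rule_format]
    define h where "h l = fill_dist (Y l)" for l
    have R0: "0 < R" "1 \<le> \<eta> * R" using R \<eta> by (auto simp: field_simps intro: less_le_trans[of 0 "1 / \<eta>"])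
    obtain \<rho> B :: real where \<rho>: "0 < \<rho>" and B: "0 \<le> B"
      and approx: "\<And>y. y \<in> ?S \<Longrightarrow> \<exists>p. hom_poly L p \<and>
      (\<forall>x\<in>?S. norm (x - y) \<le> \<rho> \<longrightarrow> norm (f x - p x) \<le> B * norm (x - y) ^ Suc L)"
      using Ck_sphere_approx[of L f] f by (metis Suc_eq_plus1)
    \<comment> \<open>Distinct nodes have geodesic distance at least \<open>2 * h / c\<close> by
      quasi-uniformity; passing to Euclidean distance costs a factor 3.\<close>
    obtain K :: nat where packing: "\<And>Z (y :: real^'n) h. 0 < h \<Longrightarrow> Z \<subseteq> cball y (R * h) \<Longrightarrow>
      (\<And>z z'. z \<in> Z \<Longrightarrow> z' \<in> Z \<Longrightarrow> z \<noteq> z' \<Longrightarrow> 2 / (3 * c) * h \<le> dist z z') \<Longrightarrow> card Z \<le> K"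
      by (rule separated_card_bound[of "2 / (3 * c)" R, where 'a = "real^'n"]) (use c in simp, blast)
    define D where "D = C * ((sqrt (K * b / a) + 1) * (B * R ^ Suc L))"
    have D: "0 \<le> D" using C B R0 a b by (auto simp: D_def)
    have main: "(\<exists>!g. mls_solution (H2_space L) (Y l) (w l) f y g) \<and>
        norm (f y - mls_approx (H2_space L) (Y l) (w l) f y) \<le> D * h l ^ Suc L"
      if y: "y \<in> ?S" and small: "R * h l \<le> 1" "R * h l \<le> \<rho>" for y l
    proof -
      define \<delta> where "\<delta> = R * h l"
      have h: "0 < h l" unfolding h_def by (rule fill_dist_pos[OF Y dim])
      have \<delta>: "0 < \<delta>" "\<delta> \<le> 1" "\<delta> \<le> \<rho>" using h R0 small by (auto simp: \<delta>_def)
      have Yfin: "finite (Y l)" "Y l \<subseteq> ?S" using Y[of l] by (auto simp: node_set_def)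
      have ny: "norm y = 1" using y by simp
      have nz: "norm z = 1" if "z \<in> Y l" for z using node_set_norm[OF Y that] .
      have dense: "\<exists>z\<in>Y l. norm (z - x) \<le> \<eta> * \<delta>" if x: "x \<in> ?S" for x
      proof -
        obtain z where z: "z \<in> Y l" "gc_dist z x \<le> h l"
          using fill_dist_nearest[OF Y x] unfolding h_def by blast
        have "norm (z - x) \<le> gc_dist z x" using x nz[OF z(1)] by (intro gc_dist_bounds) auto
        also have "\<dots> \<le> 1 * h l" using z by simp
        also have "\<dots> \<le> \<eta> * R * h l" using R0 h by (intro mult_right_mono) auto
        finally show ?thesis using z(1) by (auto simp: \<delta>_def mult.assoc)
      qed
      obtain q where q: "hom_poly L q"
        "\<And>x. x \<in> ?S \<Longrightarrow> norm (x - y) \<le> \<rho> \<Longrightarrow> norm (f x - q x) \<le> B * norm (x - y) ^ Suc L"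
        using approx[OF y] by blast
      have qy: "q y = f y" using q(2)[OF y] \<rho> by simp
      have w_eq: "w l y z = \<phi> (gc_dist y z / \<delta>)" for z by (simp add: w \<delta>_def h_def)
      have gc0: "norm (z - y) \<le> gc_dist y z" "gc_dist y z \<le> 3 * norm (z - y)" "0 \<le> gc_dist y z / \<delta>"
        if "z \<in> Y l" for z
      proof -
        show 1: "norm (z - y) \<le> gc_dist y z" "gc_dist y z \<le> 3 * norm (z - y)"
          using gc_dist_bounds[OF nz[OF that] ny] by (simp_all add: gc_dist_commute)
        show "0 \<le> gc_dist y z / \<delta>" using 1 \<delta>(1) norm_ge_zero[of "z - y"] by (intro divide_nonneg_pos) linarith+
      qed
      have card: "card {z \<in> Y l. norm (z - y) \<le> \<delta>} \<le> K"
      proof (rule packing[OF h])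
        show "{z \<in> Y l. norm (z - y) \<le> \<delta>} \<subseteq> cball y (R * h l)"
          by (auto simp: \<delta>_def dist_norm norm_minus_commute)
        fix z z' assume z: "z \<in> {z \<in> Y l. norm (z - y) \<le> \<delta>}" "z' \<in> {z \<in> Y l. norm (z - y) \<le> \<delta>}" "z \<noteq> z'"
        have "h l \<le> c * sep_dist (Y l)"
          using ratio[rule_format, of l] sep_dist_properties(1)[OF Y[of l]] by (simp add: h_def divide_le_eq)
        then have "2 / c * h l \<le> 2 * sep_dist (Y l)" using c by (simp add: field_simps)
        also have "\<dots> \<le> gc_dist z z'" using z by (intro sep_dist_properties Y) auto
        also have "\<dots> \<le> 3 * dist z z'"
          unfolding dist_norm using z nz by (intro gc_dist_bounds) auto
        finally show "2 / (3 * c) * h l \<le> dist z z'" using c by (simp add: field_simps)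
      qed
      \<comment> \<open>The geodesic distance is at most \<open>3 * \<delta> / 8\<close>, so the
        argument of \<open>\<phi>\<close> is below 1/2.\<close>
      have w_ge: "a \<le> w l y z" if "z \<in> Y l" "norm (z - y) \<le> \<delta> / 8" for z
        unfolding w_eq using gc0[OF that(1)] that \<delta> by (intro phi_ge) (auto simp: field_simps)
      have w_zero: "w l y z = 0" if "z \<in> Y l" "\<delta> < norm (z - y)" for z
        unfolding w_eq using gc0[OF that(1)] that \<delta> by (intro phi_zero) (auto simp: field_simps)
      have E: "norm (f x - q x) \<le> B * \<delta> ^ Suc L" if "x \<in> ?S" "norm (x - y) \<le> \<delta>" for x
      proof -
        have "norm (f x - q x) \<le> B * norm (x - y) ^ Suc L" using that \<delta> by (intro q) auto
        also have "\<dots> \<le> B * \<delta> ^ Suc L" using that by (intro mult_left_mono power_mono B) auto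
        finally show ?thesis .
      qed
      have E0: "0 \<le> B * \<delta> ^ Suc L" using B \<delta> by simp
      have wn: "0 \<le> w l y z" "w l y z \<le> b" if "z \<in> Y l" for z
        unfolding w_eq using gc0(3)[OF that] by (auto intro: phi_nonneg phi_le)
      have norming_l: "norm (p y) \<le> C * M \<and> (M = 0 \<longrightarrow> (\<forall>z. p z = 0))"
        if pM: "hom_poly L p" "\<And>z. z \<in> Y l \<Longrightarrow> norm (z - y) \<le> \<delta> / 8 \<Longrightarrow> norm (p z) \<le> M"
        for p :: "real^'n \<Rightarrow> 'k" and M
        by (rule norming[OF pM(1) Yfin(2) \<delta>(1,2) y]) (fact dense pM(2))+
      note facts = norming_l Yfin y \<delta>(1) C wn w_zero w_ge a b card q(1) qy E0 E
      have "\<exists>!g. mls_solution (H2_space L) (Y l) (w l) f y g"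
        by (rule mls_pointwise_error(1)[where \<delta> = \<delta> and C = C and a = a and b = b and K = K and q = q
              and E = "B * \<delta> ^ Suc L"]) (fact facts)+
      moreover have "norm (f y - mls_approx (H2_space L) (Y l) (w l) f y) \<le>
          C * ((sqrt (K * b / a) + 1) * (B * \<delta> ^ Suc L))"
        by (rule mls_pointwise_error(2)[where \<delta> = \<delta> and q = q]) (fact facts)+
      moreover have "C * ((sqrt (K * b / a) + 1) * (B * \<delta> ^ Suc L)) = D * h l ^ Suc L"
        by (simp only: D_def \<delta>_def power_mult_distrib mult_ac)
      ultimately show ?thesis by simp
    qed
    \<comment> \<open>The scale must be at most 1 for norming and at most \<open>\<rho>\<close> for
      the local approximant. Since \<open>\<rho>\<close> comes from \<open>f\<close>, this holds
      from some \<open>l\<close> on.\<close>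
    have "(\<lambda>l. R * h l) \<longlonglongrightarrow> R * 0"
      unfolding h_def by (intro tendsto_mult tendsto_const lim)
    then have "\<forall>\<^sub>F l in sequentially. R * h l < min 1 \<rho>"
      by (rule order_tendstoD(2)) (use \<rho> in simp)
    then have ev: "\<forall>\<^sub>F l in sequentially. \<forall>y\<in>?S. (\<exists>!g. mls_solution (H2_space L) (Y l) (w l) f y g) \<and>
        norm (f y - mls_approx (H2_space L) (Y l) (w l) f y) \<le> D * h l ^ Suc L"
      by eventually_elim (intro ballI main; simp)
    have "\<forall>\<^sub>F l in sequentially. mls_well_defined (H2_space L) (Y l) (w l) f"
      using ev
    proof eventually_elim
      case (elim l)
      then have "bounded ((\<lambda>y. f y - mls_approx (H2_space L) (Y l) (w l) f y) ` ?S)"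
        unfolding bounded_iff by blast
      with elim show ?case unfolding mls_well_defined_def by blast
    qed
    moreover have "(\<lambda>l. sphere_norm (\<lambda>y. f y - mls_approx (H2_space L) (Y l) (w l) f y))
          \<in> O(\<lambda>l. fill_dist (Y l) ^ (L + 1))"
    proof (rule bigoI[of _ D])
      show "\<forall>\<^sub>F l in sequentially. norm (sphere_norm (\<lambda>y. f y - mls_approx (H2_space L) (Y l) (w l) f y))
        \<le> D * norm (fill_dist (Y l) ^ (L + 1))"
        using ev
      proof eventually_elim
        case (elim l)
        let ?e = "\<lambda>y. norm (f y - mls_approx (H2_space L) (Y l) (w l) f y)"
        have h: "0 < h l" unfolding h_def by (rule fill_dist_pos[OF Y dim])
        have ne: "?S \<noteq> {}" by simp
        then obtain y where y: "y \<in> ?S" by blast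
        have le: "(SUP y\<in>?S. ?e y) \<le> D * h l ^ Suc L"
          using elim ne by (intro cSUP_least) auto
        have "bdd_above (?e ` ?S)" using elim by (intro bdd_aboveI2) blast
        then have "?e y \<le> (SUP y\<in>?S. ?e y)" by (intro cSUP_upper y)
        \<comment> \<open>\<open>bigoI\<close> concerns the absolute value of the supremum, so its
          sign is needed as well.\<close>
        then have "0 \<le> (SUP y\<in>?S. ?e y)" using norm_ge_zero order_trans by blast
        with le h show ?case by (simp add: sphere_norm_def h_def[symmetric])
      qed
    qed
    ultimately show "(\<forall>\<^sub>F l in sequentially. mls_well_defined (H2_space L) (Y l) (w l) f) \<and>
        (\<lambda>l. sphere_norm (\<lambda>y. f y - mls_approx (H2_space L) (Y l) (w l) f y))
          \<in> O(\<lambda>l. fill_dist (Y l) ^ (L + 1))" by blast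
  qed
qed

text \<open>The threshold is obtained separately for each scalar field; the larger one serves both.
  Abstract predicates let the two long statements be matched by unification.\<close>

lemma common_threshold:
  fixes P :: "real \<Rightarrow> 'a \<Rightarrow> bool"
  assumes "\<exists>r>0. \<forall>(c::real) Y (R::real) w. 0 < c \<longrightarrow> N Y \<longrightarrow> P c Y \<longrightarrow> S Y \<longrightarrow> r \<le> R \<longrightarrow> W R Y w \<longrightarrow> F Y w"
    and "\<exists>r>0. \<forall>(c::real) Y (R::real) w. 0 < c \<longrightarrow> N Y \<longrightarrow> P c Y \<longrightarrow> S Y \<longrightarrow> r \<le> R \<longrightarrow> W R Y w \<longrightarrow> G Y w"
  shows "\<exists>r>0. \<forall>(c::real) Y (R::real) w. 0 < c \<longrightarrow> N Y \<longrightarrow> P c Y \<longrightarrow> S Y \<longrightarrow> r \<le> R \<longrightarrow> W R Y w \<longrightarrow>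
    F Y w \<and> G Y w"
proof -
  obtain r1 where "0 < r1"
    "\<And>c Y R w. 0 < c \<Longrightarrow> N Y \<Longrightarrow> P c Y \<Longrightarrow> S Y \<Longrightarrow> r1 \<le> R \<Longrightarrow> W R Y w \<Longrightarrow> F Y w"
    using assms(1) by blast
  moreover obtain r2 where
    "\<And>c Y R w. 0 < c \<Longrightarrow> N Y \<Longrightarrow> P c Y \<Longrightarrow> S Y \<Longrightarrow> r2 \<le> R \<Longrightarrow> W R Y w \<Longrightarrow> G Y w"
    using assms(2) by blast
  ultimately show ?thesis
    by (intro exI[of _ "max r1 r2"]) auto
qed

theorem corollary4p6:
  fixes L :: nat and \<phi> :: "real \<Rightarrow> real"
  assumes dim: "2 \<le> CARD('n::finite)"
    and phi_cont: "continuous_on {0..} \<phi>"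
    and phi_nonneg: "\<And>t. 0 \<le> t \<Longrightarrow> 0 \<le> \<phi> t"
    and phi_pos: "\<And>t. 0 \<le> t \<Longrightarrow> t \<le> 1 / 2 \<Longrightarrow> 0 < \<phi> t"
    and phi_zero: "\<And>t. 1 \<le> t \<Longrightarrow> \<phi> t = 0"
  shows "\<exists>r>0. \<forall>(c::real) (Y :: nat \<Rightarrow> (real^'n) set) (R::real) (w :: nat \<Rightarrow> real^'n \<Rightarrow> real^'n \<Rightarrow> real).
    0 < c \<longrightarrow>
    (\<forall>l. node_set (Y l)) \<longrightarrow>
    (\<forall>l. fill_dist (Y l) / sep_dist (Y l) \<le> c) \<longrightarrow>
    (\<lambda>l. fill_dist (Y l)) \<longlonglongrightarrow> 0 \<longrightarrow>
    r \<le> R \<longrightarrow>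
    w = (\<lambda>l y z. \<phi> (gc_dist y z / (R * fill_dist (Y l)))) \<longrightarrow>
      (\<forall>f :: real^'n \<Rightarrow> real. Ck_sphere (L + 1) f \<longrightarrow>
        (\<forall>\<^sub>F l in sequentially. mls_well_defined (H2_space L) (Y l) (w l) f) \<and>
        (\<lambda>l. sphere_norm (\<lambda>y. f y - mls_approx (H2_space L) (Y l) (w l) f y))
          \<in> O(\<lambda>l. fill_dist (Y l) ^ (L + 1))) \<and>
      (\<forall>f :: real^'n \<Rightarrow> complex. Ck_sphere (L + 1) f \<longrightarrow>
        (\<forall>\<^sub>F l in sequentially. mls_well_defined (H2_space L) (Y l) (w l) f) \<and>
        (\<lambda>l. sphere_norm (\<lambda>y. f y - mls_approx (H2_space L) (Y l) (w l) f y))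
          \<in> O(\<lambda>l. fill_dist (Y l) ^ (L + 1)))"
  by (rule common_threshold[OF
        mls_convergence[where 'k = real, OF dim phi_cont phi_nonneg phi_pos phi_zero]
        mls_convergence[where 'k = complex, OF dim phi_cont phi_nonneg phi_pos phi_zero]])

end
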